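(* Let $\gamma:I\to\mathbb{R}^2$ be a $C^\infty$ curve with $0\in I$. Then $\gamma$ is $\mathcal{A}$-equivalent at $t=0$ to $Cusp_{(4,5)}(t)=(t^4,t^5)$ if and only if $\gamma'(0)=\gamma''(0)=\gamma'''(0)=\mathbf{0}$, $A\neq0$, and $$-77B^2+105AD+60AC=0,$$ where $A,B,C,D$ are as defined in the context.
   Context: $A=\det(\gamma^{(5)}(0),\gamma^{(4)}(0))$, $B=\det(\gamma^{(6)}(0),\gamma^{(4)}(0))$, $C=\det(\gamma^{(7)}(0),\gamma^{(4)}(0))$, $D=\det(\gamma^{(6)}(0),\gamma^{(5)}(0))$, where $\det(u,v)$ is the determinant of the $2\times2$ matrix with columns $u,v$. $\mathcal{A}$-equivalence: existence of $C^\infty$ diffeomorphism germs $\psi$ of $(\mathbb{R},0)$ and $\Psi$ of $\mathbb{R}^2$ with $\Psi\circ\gamma_1\circ\psi^{-1}=\gamma_2$. *)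

theory Defs
  imports "HOL-Analysis.Analysis"
begin

definition pd :: "'a::real_normed_vector \<Rightarrow> ('a \<Rightarrow> 'b::real_normed_vector) \<Rightarrow> 'a \<Rightarrow> 'b" where
  "pd v g x = vector_derivative (\<lambda>t. g (x + t *\<^sub>R v)) (at 0)"

fun ipd :: "'a::real_normed_vector list \<Rightarrow> ('a \<Rightarrow> 'b::real_normed_vector) \<Rightarrow> 'a \<Rightarrow> 'b" where
  "ipd [] f = f"
| "ipd (v # vs) f = pd v (ipd vs f)"

definition smooth_on :: "'a::euclidean_space set \<Rightarrow> ('a \<Rightarrow> 'b::real_normed_vector) \<Rightarrow> bool" where
  "smooth_on S f \<longleftrightarrow>
     (\<forall>vs. set vs \<subseteq> Basis \<longrightarrow>
        continuous_on S (ipd vs f) \<and>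
        (\<forall>v\<in>Basis. \<forall>x\<in>S.
           ((\<lambda>t. ipd vs f (x + t *\<^sub>R v)) has_vector_derivative pd v (ipd vs f) x) (at 0)))"

definition cderiv :: "nat \<Rightarrow> (real \<Rightarrow> 'b::real_normed_vector) \<Rightarrow> real \<Rightarrow> 'b" where
  "cderiv k \<gamma> = ipd (replicate k 1) \<gamma>"

definition det2 :: "real^2 \<Rightarrow> real^2 \<Rightarrow> real" where
  "det2 u v = det (transpose (vector [u, v] :: real^2^2))"

definition diffeo_germ :: "('a::euclidean_space \<Rightarrow> 'a) \<Rightarrow> ('a \<Rightarrow> 'a) \<Rightarrow> 'a \<Rightarrow> 'a \<Rightarrow> bool" where
  "diffeo_germ f g a b \<longleftrightarrow> f a = b \<and> g b = a \<and>
     (\<exists>U. open U \<and> a \<in> U \<and> smooth_on U f \<and> (\<forall>x\<in>U. g (f x) = x)) \<and>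
     (\<exists>V. open V \<and> b \<in> V \<and> smooth_on V g \<and> (\<forall>y\<in>V. f (g y) = y))"

definition A_equivalent :: "(real \<Rightarrow> real^2) \<Rightarrow> (real \<Rightarrow> real^2) \<Rightarrow> bool" where
  "A_equivalent \<gamma>1 \<gamma>2 \<longleftrightarrow>
     (\<exists>\<psi> \<psi>inv \<Psi> \<Psi>inv. diffeo_germ \<psi> \<psi>inv 0 0 \<and> diffeo_germ \<Psi> \<Psi>inv (\<gamma>1 0) (\<gamma>2 0) \<and>
        (\<forall>\<^sub>F t in nhds 0. \<Psi> (\<gamma>1 (\<psi>inv t)) = \<gamma>2 t))"

definition cusp45 :: "real \<Rightarrow> real^2" where
  "cusp45 t = vector [t ^ 4, t ^ 5]"

end

theory Submission
  imports Defs "HOL-Library.Landau_Symbols"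
begin

text \<open>
  Necessity: a curve equivalent to the cusp has the form \<open>\<Phi> (\<phi>^4, \<phi>^5)\<close>. The quadratic terms of \<open>\<Phi>\<close>
  only contribute in order at least 8, so the 7-jet of the curve is that of \<open>P \<phi>^4 + Q \<phi>^5\<close> with
  linearly independent \<open>P\<close>, \<open>Q\<close>, and the condition becomes a polynomial identity in the
  Taylor coefficients of \<open>\<phi>\<close>.

  Sufficiency: the semigroup generated by 4 and 5 misses exactly 1, 2, 3, 6, 7 and 11. The hypothesis is
  what allows a polynomial change of parameter to remove the terms of order 6, 7 and 11 from both
  components of the curve. A smooth function \<open>f\<close> whose Taylor coefficients vanish at all gaps is
  \<open>b0 (u^4) + u^5 * b1 (u^4) + u^10 * b2 (u^4) + u^15 * b3 (u^4)\<close> with smooth \<open>bj\<close>: Borel's lemma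
  matches all Taylor coefficients, and the flat remainder is treated separately through
  \<open>u = root 4 (u^4)\<close>. Hence the reparametrised curve is \<open>\<Phi> (u^4, u^5)\<close> with \<open>\<Phi>\<close> a local
  diffeomorphism by the inverse function theorem.
\<close>

section \<open>Smooth functions on open sets\<close>

text \<open>The constants come from a count of unknowns. Let w_k be the Taylor coefficient vectors;
  A \<noteq> 0 permits w_6 = x6 w_4 + y6 w_5 and w_7 = x7 w_4 + y7 w_5. Removing orders 6 and 7 by a
  parameter u + s2 u^2 + s3 u^3 + s4 u^4 means solving four scalar equations in three unknowns. The
  one left over reads y7 = 5/4 x6 + 11/10 y6^2, which is the stated equation once factorials are
  cleared. Order 11 imposes no condition: adding a u^7 + b u^8 to the parameter leaves all orders
  below 10 alone and offers two free coefficients for two coordinates. The remaining orders lie in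
  the semigroup and are absorbed by the diffeomorphism of the plane. As the curve is merely smooth,
  this absorption cannot be done with power series, whence the flat functions. Smoothness is given
  through iterated partial derivatives along basis vectors, and \<open>pd\<close> is meaningful only
  where the derivative exists; the calculus rules are therefore derived for classes of finite order,
  which are open to induction.\<close>

definition has_partial :: "'a::real_normed_vector \<Rightarrow> ('a \<Rightarrow> 'b::real_normed_vector) \<Rightarrow> 'b \<Rightarrow> 'a \<Rightarrow> bool" where
  "has_partial v f d x \<longleftrightarrow> ((\<lambda>t. f (x + t *\<^sub>R v)) has_vector_derivative d) (at 0)"

text \<open>Differentiability of finite order. Any function \<open>g\<close> may witness a partial
  derivative, not only the chosen value \<open>pd\<close>, so an induction on the order can exhibit
  an explicit formula.\<close>

fun C_on :: "nat \<Rightarrow> 'a::euclidean_space set \<Rightarrow> ('a \<Rightarrow> 'b::real_normed_vector) \<Rightarrow> bool" where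
  "C_on 0 S f \<longleftrightarrow> continuous_on S f"
| "C_on (Suc k) S f \<longleftrightarrow> continuous_on S f \<and>
     (\<forall>v\<in>Basis. \<exists>g. C_on k S g \<and> (\<forall>x\<in>S. has_partial v f (g x) x))"

lemma has_partial_imp_pd: "has_partial v f d x \<Longrightarrow> pd v f x = d"
  unfolding has_partial_def pd_def by (rule vector_derivative_at)

lemma eventually_line_in_open:
  fixes x v :: "'a::real_normed_vector"
  assumes "open S" "x \<in> S"
  shows "\<forall>\<^sub>F t in nhds 0. x + t *\<^sub>R v \<in> S"
proof -
  have "((\<lambda>t. x + t *\<^sub>R v) \<longlongrightarrow> x + 0 *\<^sub>R v) (nhds 0)"
    by (intro tendsto_intros filterlim_ident)
  then show ?thesis
    using assms by (simp add: topological_tendstoD)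
qed

lemma has_partial_cong:
  assumes "open S" "x \<in> S" "\<And>y. y \<in> S \<Longrightarrow> f y = g y"
  shows "has_partial v f d x \<longleftrightarrow> has_partial v g d x"
  unfolding has_partial_def
proof (rule has_vector_derivative_cong_ev)
  show "\<forall>\<^sub>F t in nhds 0. t \<in> UNIV \<longrightarrow> f (x + t *\<^sub>R v) = g (x + t *\<^sub>R v)"
    using eventually_line_in_open[OF assms(1,2)] by (rule eventually_mono) (use assms(3) in auto)
  show "f (x + 0 *\<^sub>R v) = g (x + 0 *\<^sub>R v)" using assms by simp
qed

lemma C_on_cong:
  assumes "open S" "\<And>y. y \<in> S \<Longrightarrow> f y = g y"
  shows "C_on k S f \<longleftrightarrow> C_on k S g"
proof -
  have "continuous_on S f \<longleftrightarrow> continuous_on S g"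
    using assms(2) by (intro continuous_on_cong) auto
  moreover have "has_partial v f d x \<longleftrightarrow> has_partial v g d x" if "x \<in> S" for v d x
    using has_partial_cong[OF assms(1) that] assms(2) by blast
  ultimately show ?thesis by (cases k) simp_all
qed

lemma C_on_imp_continuous: "C_on k S f \<Longrightarrow> continuous_on S f"
  by (cases k) auto

lemma C_on_SucD: "C_on (Suc k) S f \<Longrightarrow> C_on k S f"
proof (induction k arbitrary: f)
  case (Suc k)
  have "\<exists>g. C_on k S g \<and> (\<forall>x\<in>S. has_partial v f (g x) x)" if "v \<in> Basis" for v
    using Suc.prems Suc.IH that by (subst (asm) C_on.simps) blast
  then show ?case using Suc.prems by simp
qed simp

lemma C_on_pd:
  assumes "open S" "C_on (Suc k) S f" "v \<in> Basis"
  shows "C_on k S (pd v f)" and "\<And>x. x \<in> S \<Longrightarrow> has_partial v f (pd v f x) x"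
proof -
  obtain g where g: "C_on k S g" "\<And>x. x \<in> S \<Longrightarrow> has_partial v f (g x) x"
    using assms by auto
  then have "pd v f x = g x" if "x \<in> S" for x using has_partial_imp_pd that by blast
  with g show "C_on k S (pd v f)" "\<And>x. x \<in> S \<Longrightarrow> has_partial v f (pd v f x) x"
    using C_on_cong[OF assms(1), of "pd v f" g] by simp_all
qed

lemma C_on_ipd:
  assumes "open S" "C_on (length vs + k) S f" "set vs \<subseteq> Basis"
  shows "C_on k S (ipd vs f)"
  using assms(2,3)
proof (induction vs arbitrary: k)
  case (Cons v vs)
  then have "C_on (Suc k) S (ipd vs f)" by (simp del: C_on.simps)
  with Cons.prems show ?case using C_on_pd(1)[OF assms(1), of k "ipd vs f" v] by simp
qed simp

lemma ipd_append: "ipd (vs @ ws) f = ipd vs (ipd ws f)"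
  by (induction vs) auto

lemma smooth_on_pd: "smooth_on S f \<Longrightarrow> v \<in> Basis \<Longrightarrow> smooth_on S (pd v f)"
  unfolding smooth_on_def
proof (intro allI impI)
  fix vs :: "'a list"
  assume f: "\<forall>vs. set vs \<subseteq> Basis \<longrightarrow> continuous_on S (ipd vs f) \<and>
     (\<forall>v\<in>Basis. \<forall>x\<in>S. ((\<lambda>t. ipd vs f (x + t *\<^sub>R v)) has_vector_derivative pd v (ipd vs f) x) (at 0))"
    and "v \<in> Basis" "set vs \<subseteq> Basis"
  then show "continuous_on S (ipd vs (pd v f)) \<and>
     (\<forall>w\<in>Basis. \<forall>x\<in>S. ((\<lambda>t. ipd vs (pd v f) (x + t *\<^sub>R w)) has_vector_derivative pd w (ipd vs (pd v f)) x) (at 0))"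
    \<comment> \<open>The last entry of the list is the derivative taken first, so differentiating
      \<open>f\<close> beforehand appends \<open>v\<close> at the end.\<close>
    using f[rule_format, of "vs @ [v]"] by (simp add: ipd_append)
qed

lemma smooth_on_partial: "smooth_on S f \<Longrightarrow> v \<in> Basis \<Longrightarrow> x \<in> S \<Longrightarrow> has_partial v f (pd v f x) x"
  unfolding smooth_on_def has_partial_def by (metis empty_set empty_subsetI ipd.simps(1))

lemma smooth_on_continuous: "smooth_on S f \<Longrightarrow> continuous_on S f"
  unfolding smooth_on_def by (metis empty_set empty_subsetI ipd.simps(1))

lemma smooth_on_imp_C_on: "smooth_on S f \<Longrightarrow> C_on k S f"
proof (induction k arbitrary: f)
  case (Suc k)
  then show ?case
    using smooth_on_pd smooth_on_partial smooth_on_continuous by (auto intro!: exI[of _ "pd _ f"])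
qed (simp add: smooth_on_continuous)

text \<open>The bridge from \<open>smooth_on\<close> to induction on the order. On an open set a
  partial derivative depends only on values inside the set, which lets any witness be exchanged for
  \<open>pd\<close>.\<close>

lemma smooth_on_iff_C_on:
  assumes "open S"
  shows "smooth_on S f \<longleftrightarrow> (\<forall>k. C_on k S f)"
proof
  assume f: "\<forall>k. C_on k S f"
  show "smooth_on S f"
    unfolding smooth_on_def
  proof (intro allI impI)
    fix vs :: "'a list"
    assume "set vs \<subseteq> Basis"
    then have "C_on (Suc 0) S (ipd vs f)" using f C_on_ipd[OF assms] by blast
    then show "continuous_on S (ipd vs f) \<and> (\<forall>v\<in>Basis. \<forall>x\<in>S.
        ((\<lambda>t. ipd vs f (x + t *\<^sub>R v)) has_vector_derivative pd v (ipd vs f) x) (at 0))"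
      using C_on_pd(2)[OF assms] C_on_imp_continuous unfolding has_partial_def by blast
  qed
qed (use smooth_on_imp_C_on in blast)

lemma smooth_on_subset: "smooth_on S f \<Longrightarrow> T \<subseteq> S \<Longrightarrow> smooth_on T f"
  unfolding smooth_on_def by (meson continuous_on_subset subsetD)

lemma C_on_const: "C_on k S (\<lambda>x. c)"
proof (induction k arbitrary: c)
  case (Suc k)
  then show ?case by (auto intro!: exI[of _ "\<lambda>x. 0"] simp: has_partial_def)
qed simp

lemma C_on_add: "C_on k S f \<Longrightarrow> C_on k S g \<Longrightarrow> C_on k S (\<lambda>x. f x + g x)"
proof (induction k arbitrary: f g)
  case (Suc k)
  have "\<exists>h. C_on k S h \<and> (\<forall>x\<in>S. has_partial v (\<lambda>x. f x + g x) (h x) x)" if v: "v \<in> Basis" for v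
  proof -
    obtain f' g' where "C_on k S f'" "C_on k S g'"
      "\<forall>x\<in>S. has_partial v f (f' x) x" "\<forall>x\<in>S. has_partial v g (g' x) x"
      using Suc.prems v by (metis C_on.simps(2))
    then show ?thesis using Suc.IH[of f' g'] unfolding has_partial_def
      by (intro exI[of _ "\<lambda>x. f' x + g' x"]) (auto intro: has_vector_derivative_add)
  qed
  then show ?case using Suc.prems by (simp add: continuous_on_add)
qed (simp add: continuous_on_add)

lemma C_on_mult:
  fixes f g :: "'a::euclidean_space \<Rightarrow> real"
  shows "C_on k S f \<Longrightarrow> C_on k S g \<Longrightarrow> C_on k S (\<lambda>x. f x * g x)"
proof (induction k arbitrary: f g)
  case (Suc k)
  have "\<exists>h. C_on k S h \<and> (\<forall>x\<in>S. has_partial v (\<lambda>x. f x * g x) (h x) x)" if v: "v \<in> Basis" for v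
  proof -
    obtain f' g' where *: "C_on k S f'" "C_on k S g'"
      "\<forall>x\<in>S. has_partial v f (f' x) x" "\<forall>x\<in>S. has_partial v g (g' x) x"
      using Suc.prems v by (metis C_on.simps(2))
    have "C_on k S (\<lambda>x. f x * g' x + f' x * g x)"
      using Suc.prems * by (intro C_on_add Suc.IH) (auto dest: C_on_SucD simp del: C_on.simps)
    moreover have "has_partial v (\<lambda>x. f x * g x) (f x * g' x + f' x * g x) x" if "x \<in> S" for x
      using *(3,4) that has_vector_derivative_mult[of "\<lambda>t. f (x + t *\<^sub>R v)" "f' x" 0 UNIV "\<lambda>t. g (x + t *\<^sub>R v)" "g' x"]
      unfolding has_partial_def by simp
    ultimately show ?thesis by blast
  qed
  then show ?case using Suc.prems by (simp add: continuous_on_mult)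
qed (simp add: continuous_on_mult)

lemma C_on_sum:
  "(\<And>i. i \<in> A \<Longrightarrow> C_on k S (f i)) \<Longrightarrow> C_on k S (\<lambda>x. \<Sum>i\<in>A. f i x)"
  by (induction A rule: infinite_finite_induct) (simp_all add: C_on_const C_on_add del: C_on.simps)

lemma C_on_inner_const: "C_on k S (\<lambda>x. x \<bullet> c)"
proof (cases k)
  case (Suc k')
  have "has_partial v (\<lambda>x. x \<bullet> c) (v \<bullet> c) x" for x v :: 'a
    unfolding has_partial_def has_real_derivative_iff_has_vector_derivative[symmetric]
    by (auto intro!: derivative_eq_intros simp: inner_add_left)
  then have "\<exists>g. C_on k' S g \<and> (\<forall>x\<in>S. has_partial v (\<lambda>x. x \<bullet> c) (g x) x)" for v
    by (intro exI[of _ "\<lambda>x. v \<bullet> c"]) (simp add: C_on_const)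
  then show ?thesis using Suc by (simp add: continuous_intros)
qed (auto intro!: continuous_intros)

lemma C_on_ident_real: "C_on k S (\<lambda>x::real. x)"
  using C_on_inner_const[of k S "1::real"] by simp

text \<open>The derivative -1/x^2 is a polynomial in 1/x, so the induction closes with the product
  rule alone.\<close>

lemma C_on_inverse: "C_on k (- {0}) (inverse :: real \<Rightarrow> real)"
proof (induction k)
  case (Suc k)
  have "has_partial 1 inverse (- 1 * (inverse x * inverse x)) x" if "x \<noteq> 0" for x :: real
    unfolding has_partial_def has_real_derivative_iff_has_vector_derivative[symmetric]
    using that by (auto intro!: derivative_eq_intros)
  moreover have "C_on k (- {0}) (\<lambda>x::real. - 1 * (inverse x * inverse x))"
    by (intro C_on_mult C_on_const Suc)
  ultimately have "\<exists>g. C_on k (- {0}) g \<and> (\<forall>x\<in>- {0}. has_partial (1::real) inverse (g x) x)"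
    by (intro exI[of _ "\<lambda>x. - 1 * (inverse x * inverse x)"]) blast
  then show ?case by (auto intro!: continuous_intros)
qed (auto intro!: continuous_intros)

lemma has_partial_inner: "has_partial v f d x \<Longrightarrow> has_partial v (\<lambda>x. f x \<bullet> b) (d \<bullet> b) x"
  unfolding has_partial_def has_vector_derivative_def
  by (drule has_derivative_inner_left[of _ _ _ b]) (simp add: inner_scaleR_left)

lemma has_partial_componentwise:
  fixes f :: "'a::real_normed_vector \<Rightarrow> 'b::euclidean_space"
  assumes "\<And>b. b \<in> Basis \<Longrightarrow> has_partial v (\<lambda>x. f x \<bullet> b) (d \<bullet> b) x"
  shows "has_partial v f d x"
  unfolding has_partial_def has_vector_derivative_def
  using assms unfolding has_derivative_componentwise_within[of _ "\<lambda>x. x *\<^sub>R d"]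
  by (auto simp: has_partial_def has_vector_derivative_def)

text \<open>Since \<open>C_on\<close> asks only that some derivative function exist, derivatives of
  the components can be chosen separately and reassembled. It then suffices to prove product and
  chain rules for real values.\<close>

lemma C_on_componentwise:
  fixes f :: "'a::euclidean_space \<Rightarrow> 'b::euclidean_space"
  shows "C_on k S f \<longleftrightarrow> (\<forall>b\<in>Basis. C_on k S (\<lambda>x. f x \<bullet> b))"
proof (induction k arbitrary: f)
  case 0
  show ?case by (simp add: continuous_on_componentwise[symmetric])
next
  case (Suc k)
  show ?case
  proof
    assume f: "C_on (Suc k) S f"
    have "\<exists>g. C_on k S g \<and> (\<forall>x\<in>S. has_partial v (\<lambda>x. f x \<bullet> b) (g x) x)"
      if v: "v \<in> Basis" and b: "b \<in> Basis" for v b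
    proof -
      obtain g where g: "C_on k S g" "\<forall>x\<in>S. has_partial v f (g x) x" using f v by auto
      with Suc b show ?thesis by (intro exI[of _ "\<lambda>x. g x \<bullet> b"]) (blast intro: has_partial_inner)
    qed
    then show "\<forall>b\<in>Basis. C_on (Suc k) S (\<lambda>x. f x \<bullet> b)"
      using f by (simp add: continuous_on_componentwise[symmetric] continuous_on_inner)
  next
    assume f: "\<forall>b\<in>Basis. C_on (Suc k) S (\<lambda>x. f x \<bullet> b)"
    have "\<exists>g. C_on k S g \<and> (\<forall>x\<in>S. has_partial v f (g x) x)" if v: "v \<in> Basis" for v
    proof -
      have "\<exists>g. \<forall>b\<in>Basis. C_on k S (g b) \<and> (\<forall>x\<in>S. has_partial v (\<lambda>x. f x \<bullet> b) (g b x) x)"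
        by (rule bchoice) (use f v in auto)
      then obtain g where g: "\<And>b. b \<in> Basis \<Longrightarrow> C_on k S (g b)"
        "\<And>b x. b \<in> Basis \<Longrightarrow> x \<in> S \<Longrightarrow> has_partial v (\<lambda>x. f x \<bullet> b) (g b x) x" by blast
      define G where "G x = (\<Sum>b\<in>Basis. g b x *\<^sub>R b)" for x
      have [simp]: "G x \<bullet> b = g b x" if "b \<in> Basis" for x b
        using that by (simp add: G_def)
      have "C_on k S (\<lambda>x. G x \<bullet> b)" if "b \<in> Basis" for b
        using g(1)[OF that] that by simp
      then have "C_on k S G" using Suc by blast
      moreover have "has_partial v f (G x) x" if "x \<in> S" for x
        by (rule has_partial_componentwise[of v f]) (use that g(2) in simp)
      ultimately show ?thesis by blast
    qed
    moreover have "continuous_on S f"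
      using f by (subst continuous_on_componentwise) auto
    ultimately show "C_on (Suc k) S f" by simp
  qed
qed

text \<open>The segment from x to x + h is replaced by a path with one leg per basis vector. The
  mean value theorem on a leg yields a partial derivative at a nearby point, and continuity compares
  it with the one at x.\<close>

lemma has_derivative_of_partials:
  fixes f :: "'a::euclidean_space \<Rightarrow> real"
  assumes S: "open S" "x \<in> S"
    and part: "\<And>v y. v \<in> Basis \<Longrightarrow> y \<in> S \<Longrightarrow> has_partial v f (D v y) y"
    and cont: "\<And>v. v \<in> Basis \<Longrightarrow> continuous_on S (D v)"
  shows "(f has_derivative (\<lambda>h. \<Sum>v\<in>Basis. (h \<bullet> v) * D v x)) (at x)"
proof -
  \<comment> \<open>The orthogonal projection of \<open>h\<close> to the span of \<open>A\<close>;
    enlarging \<open>A\<close> by one basis vector adds one leg to the path.\<close>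
  define P where "P A h = (\<Sum>v\<in>A. (h \<bullet> v) *\<^sub>R v)" for A and h :: 'a
  \<comment> \<open>Every point of a leg differs from \<open>x\<close> by a vector whose coordinates
    are bounded by those of \<open>h\<close>, so it stays in the ball where the partial derivatives
    are controlled.\<close>
  have P_norm: "norm (P A h + s *\<^sub>R v) \<le> norm h"
    if "v \<in> Basis" "v \<notin> A" "A \<subseteq> Basis" "s = r * (h \<bullet> v)" "\<bar>r\<bar> \<le> 1" for A v s h r
  proof (rule norm_le_componentwise)
    fix b :: 'a assume b: "b \<in> Basis"
    have fin: "finite A" using finite_subset[OF that(3) finite_Basis] .
    have "P A h \<bullet> b = (\<Sum>w\<in>A. if w = b then h \<bullet> b else 0)"
      unfolding P_def inner_sum_left using b that(3) by (intro sum.cong) (auto simp: inner_Basis)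
    then have 1: "P A h \<bullet> b = (if b \<in> A then h \<bullet> b else 0)"
      using fin by simp
    show "\<bar>(P A h + s *\<^sub>R v) \<bullet> b\<bar> \<le> \<bar>h \<bullet> b\<bar>"
      using that b by (auto simp: inner_add_left 1 inner_Basis abs_mult mult_left_le_one_le)
  qed
  have key: "\<exists>d>0. \<forall>h. norm h < d \<longrightarrow> \<bar>f (x + P A h) - f x - (\<Sum>v\<in>A. (h \<bullet> v) * D v x)\<bar> \<le> e * norm h"
    if "finite A" "A \<subseteq> Basis" "e > 0" for A e
    using that
  proof (induction A arbitrary: e rule: finite_induct)
    case empty
    then show ?case by (auto simp: P_def intro!: exI[of _ 1])
  next
    case (insert v A)
    then have v: "v \<in> Basis" and A: "A \<subseteq> Basis" by auto
    obtain d1 where d1: "d1 > 0"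
      "\<And>h. norm h < d1 \<Longrightarrow> \<bar>f (x + P A h) - f x - (\<Sum>v\<in>A. (h \<bullet> v) * D v x)\<bar> \<le> (e/2) * norm h"
      using insert.IH[OF A, of "e/2"] insert.prems by auto
    have "\<forall>\<^sub>F y in nhds x. dist (D v y) (D v x) < e/2 \<and> y \<in> S"
      using cont[OF v] S insert.prems
      by (intro eventually_conj eventually_nhds_in_open tendstoD)
        (auto simp: continuous_on_eq_continuous_at isCont_def tendsto_at_iff_tendsto_nhds)
    then obtain d2 where d2: "d2 > 0" "\<And>y. dist y x < d2 \<Longrightarrow> \<bar>D v y - D v x\<bar> < e/2 \<and> y \<in> S"
      by (auto simp: eventually_nhds_metric dist_real_def)
    have "\<bar>f (x + P (insert v A) h) - f x - (\<Sum>v\<in>insert v A. (h \<bullet> v) * D v x)\<bar> \<le> e * norm h"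
      if h: "norm h < min d1 d2" for h
    proof -
      define y where "y r = x + P A h + (r * (h \<bullet> v)) *\<^sub>R v" for r
      have yd: "dist (y r) x < d2" if "\<bar>r\<bar> \<le> 1" for r
        using P_norm[OF v insert.hyps(2) A refl that, of h] h by (simp add: y_def dist_norm add.assoc)
      have der: "((\<lambda>r. f (y r)) has_real_derivative (h \<bullet> v) * D v (y r)) (at r)" if r: "\<bar>r\<bar> \<le> 1" for r
      proof -
        have "((\<lambda>t. f (y r + t *\<^sub>R v)) has_real_derivative D v (y r)) (at 0)"
          using part[OF v, of "y r"] d2(2)[OF yd[OF r]]
          unfolding has_partial_def has_real_derivative_iff_has_vector_derivative by blast
        then have "((\<lambda>t. f (y r + t *\<^sub>R v)) has_real_derivative D v (y r)) (at ((r - r) * (h \<bullet> v)))" by simp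
        then have "((\<lambda>s. f (y r + ((s - r) * (h \<bullet> v)) *\<^sub>R v)) has_real_derivative D v (y r) * (h \<bullet> v)) (at r)"
          by (rule DERIV_chain2) (auto intro!: derivative_eq_intros)
        moreover have "y r + ((s - r) * (h \<bullet> v)) *\<^sub>R v = y s" for s
          by (simp add: y_def algebra_simps)
        ultimately show ?thesis by (simp add: mult.commute)
      qed
      have "\<exists>z::real. 0 < z \<and> z < 1 \<and> f (y 1) - f (y 0) = (1 - 0) * ((h \<bullet> v) * D v (y z))"
        by (rule MVT2) (auto intro: der)
      then obtain z :: real where z: "0 < z" "z < 1" "f (y 1) - f (y 0) = (h \<bullet> v) * D v (y z)" by auto
      have "\<bar>D v (y z) - D v x\<bar> \<le> e / 2" using d2(2)[OF yd, of z] z by auto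
      then have "\<bar>(h \<bullet> v) * (D v (y z) - D v x)\<bar> \<le> norm h * (e / 2)"
        unfolding abs_mult using Basis_le_norm[OF v] by (intro mult_mono) auto
      moreover have "y 0 = x + P A h" "y 1 = x + P (insert v A) h"
        using insert.hyps by (simp_all add: y_def P_def algebra_simps)
      moreover have "\<bar>f (x + P A h) - f x - (\<Sum>v\<in>A. (h \<bullet> v) * D v x)\<bar> \<le> (e/2) * norm h"
        using d1(2) h by auto
      moreover have "f (x + P (insert v A) h) - f x - (\<Sum>v\<in>insert v A. (h \<bullet> v) * D v x) =
          (f (x + P A h) - f x - (\<Sum>v\<in>A. (h \<bullet> v) * D v x)) + (h \<bullet> v) * (D v (y z) - D v x)"
        using z(3) insert.hyps calculation by (simp add: right_diff_distrib)
      ultimately show ?thesis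
        using abs_triangle_ineq[of "f (x + P A h) - f x - (\<Sum>v\<in>A. (h \<bullet> v) * D v x)" "(h \<bullet> v) * (D v (y z) - D v x)"]
        by (simp only:) (simp add: mult.commute)
    qed
    then show ?case using d1(1) d2(1) by (intro exI[of _ "min d1 d2"]) auto
  qed
  have P_all: "P Basis h = h" for h :: 'a by (simp add: P_def euclidean_representation)
  show ?thesis
    unfolding has_derivative_at_alt
  proof (intro conjI allI impI)
    show "bounded_linear (\<lambda>h. \<Sum>v\<in>Basis. (h \<bullet> v) * D v x)"
      by (intro bounded_linear_sum bounded_linear_mult_const bounded_linear_inner_left)
    fix e :: real assume "e > 0"
    from key[OF finite_Basis order_refl this] obtain d where "d > 0"
      "\<And>h. norm h < d \<Longrightarrow> \<bar>f (x + h) - f x - (\<Sum>v\<in>Basis. (h \<bullet> v) * D v x)\<bar> \<le> e * norm h"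
      unfolding P_all by blast
    from this(1) this(2)[of "y - x" for y]
    show "\<exists>d>0. \<forall>y. norm (y - x) < d \<longrightarrow>
        norm (f y - f x - (\<Sum>v\<in>Basis. ((y - x) \<bullet> v) * D v x)) \<le> e * norm (y - x)"
      by auto
  qed
qed

lemma C_on_has_derivative:
  fixes f :: "'a::euclidean_space \<Rightarrow> real"
  assumes "open S" "x \<in> S" "C_on (Suc k) S f"
  shows "(f has_derivative (\<lambda>h. \<Sum>v\<in>Basis. (h \<bullet> v) * pd v f x)) (at x)"
  by (rule has_derivative_of_partials[OF assms(1,2) C_on_pd(2)[OF assms(1,3)]])
    (assumption | rule C_on_imp_continuous[OF C_on_pd(1)[OF assms(1,3)]])+

lemma has_partial_compose:
  fixes F :: "'b::euclidean_space \<Rightarrow> real" and f :: "'a::real_normed_vector \<Rightarrow> 'b"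
  assumes "open T" "f x \<in> T" "C_on (Suc k) T F" "has_partial v f d x"
  shows "has_partial v (\<lambda>x. F (f x)) (\<Sum>b\<in>Basis. (d \<bullet> b) * pd b F (f x)) x"
proof -
  have F: "(F has_derivative (\<lambda>h. \<Sum>b\<in>Basis. (h \<bullet> b) * pd b F (f x))) (at (f (x + 0 *\<^sub>R v)))"
    using C_on_has_derivative[OF assms(1-3)] by simp
  have "((\<lambda>t. f (x + t *\<^sub>R v)) has_derivative (\<lambda>t. t *\<^sub>R d)) (at 0)"
    using assms(4) unfolding has_partial_def has_vector_derivative_def .
  from has_derivative_compose[OF this F]
  have "((\<lambda>t. F (f (x + t *\<^sub>R v))) has_derivative
      (\<lambda>t. \<Sum>b\<in>Basis. (t *\<^sub>R d \<bullet> b) * pd b F (f x))) (at 0)" .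
  moreover have "(\<Sum>b\<in>Basis. (t *\<^sub>R d \<bullet> b) * pd b F (f x)) = t *\<^sub>R (\<Sum>b\<in>Basis. (d \<bullet> b) * pd b F (f x))" for t
    by (simp add: sum_distrib_left mult.assoc)
  ultimately show ?thesis
    unfolding has_partial_def has_vector_derivative_def by (simp only:)
qed

text \<open>The partial derivatives of \<open>F\<close> are composed with the same \<open>f\<close>,
  so the induction hypothesis is kept general in \<open>F\<close>.\<close>

lemma C_on_compose:
  fixes F :: "'b::euclidean_space \<Rightarrow> real" and f :: "'a::euclidean_space \<Rightarrow> 'b"
  assumes T: "open T" and S: "open S" and "f ` S \<subseteq> T"
  shows "C_on k T F \<Longrightarrow> C_on k S f \<Longrightarrow> C_on k S (\<lambda>x. F (f x))"
proof (induction k arbitrary: F)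
  case 0
  then show ?case using assms(3) continuous_on_compose2[of T F S f] by simp
next
  case (Suc k)
  have "\<exists>g. C_on k S g \<and> (\<forall>x\<in>S. has_partial v (\<lambda>x. F (f x)) (g x) x)" if v: "v \<in> Basis" for v
  proof -
    obtain f' where f': "C_on k S f'" "\<And>x. x \<in> S \<Longrightarrow> has_partial v f (f' x) x"
      using Suc.prems(2) v by auto
    have "C_on k S (\<lambda>x. \<Sum>b\<in>Basis. (f' x \<bullet> b) * pd b F (f x))"
      using Suc.prems f'(1) C_on_componentwise[of k S f']
      by (intro C_on_sum C_on_mult Suc.IH C_on_pd(1)[OF T]) (auto dest: C_on_SucD simp del: C_on.simps)
    moreover have "has_partial v (\<lambda>x. F (f x)) (\<Sum>b\<in>Basis. (f' x \<bullet> b) * pd b F (f x)) x" if "x \<in> S" for x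
      using has_partial_compose[OF T _ Suc.prems(1) f'(2)[OF that]] that assms(3) by blast
    ultimately show ?thesis by blast
  qed
  moreover have "continuous_on S (\<lambda>x. F (f x))"
    using Suc.prems assms(3) continuous_on_compose2[of T F S f] by simp
  ultimately show ?case by simp
qed

section \<open>Closure properties and total derivatives of smooth functions\<close>

lemma smooth_on_componentwise:
  fixes f :: "'a::euclidean_space \<Rightarrow> 'b::euclidean_space"
  assumes "open S"
  shows "smooth_on S f \<longleftrightarrow> (\<forall>b\<in>Basis. smooth_on S (\<lambda>x. f x \<bullet> b))"
  unfolding smooth_on_iff_C_on[OF assms] C_on_componentwise[of _ S f] by blast

lemma smooth_on_const: "open S \<Longrightarrow> smooth_on S (\<lambda>x. c)"
  by (simp add: smooth_on_iff_C_on C_on_const)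

lemma smooth_on_add: "open S \<Longrightarrow> smooth_on S f \<Longrightarrow> smooth_on S g \<Longrightarrow> smooth_on S (\<lambda>x. f x + g x)"
  by (simp add: smooth_on_iff_C_on C_on_add)

lemma smooth_on_mult:
  fixes f g :: "'a::euclidean_space \<Rightarrow> real"
  shows "open S \<Longrightarrow> smooth_on S f \<Longrightarrow> smooth_on S g \<Longrightarrow> smooth_on S (\<lambda>x. f x * g x)"
  by (simp add: smooth_on_iff_C_on C_on_mult)

lemma smooth_on_minus:
  fixes f g :: "'a::euclidean_space \<Rightarrow> real"
  shows "open S \<Longrightarrow> smooth_on S f \<Longrightarrow> smooth_on S g \<Longrightarrow> smooth_on S (\<lambda>x. f x - g x)"
  using smooth_on_add[of S f "\<lambda>x. (-1) * g x"] smooth_on_mult[of S "\<lambda>x. -1" g] smooth_on_const[of S "-1::real"]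
  by simp

lemma smooth_on_power:
  fixes f :: "'a::euclidean_space \<Rightarrow> real"
  shows "open S \<Longrightarrow> smooth_on S f \<Longrightarrow> smooth_on S (\<lambda>x. f x ^ n)"
  by (induction n) (simp_all add: smooth_on_const smooth_on_mult)

lemma smooth_on_inner_const: "open S \<Longrightarrow> smooth_on S (\<lambda>x. x \<bullet> c)"
  by (simp add: smooth_on_iff_C_on C_on_inner_const)

lemma smooth_on_ident_real: "open S \<Longrightarrow> smooth_on S (\<lambda>x::real. x)"
  by (simp add: smooth_on_iff_C_on C_on_ident_real)

lemma smooth_on_compose:
  fixes F :: "'b::euclidean_space \<Rightarrow> real" and f :: "'a::euclidean_space \<Rightarrow> 'b"
  assumes "open T" "open S" "f ` S \<subseteq> T" "smooth_on T F" "smooth_on S f"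
  shows "smooth_on S (\<lambda>x. F (f x))"
  using C_on_compose[OF assms(1-3)] assms(4,5) by (simp add: smooth_on_iff_C_on assms(1,2))

lemma smooth_on_inverse:
  fixes f :: "'a::euclidean_space \<Rightarrow> real"
  assumes "open S" "smooth_on S f" "\<And>x. x \<in> S \<Longrightarrow> f x \<noteq> 0"
  shows "smooth_on S (\<lambda>x. inverse (f x))"
proof -
  have "open (- {0::real})" by auto
  then show ?thesis
    using assms C_on_inverse smooth_on_iff_C_on[of "- {0::real}" inverse]
    by (intro smooth_on_compose[of "- {0}" S f inverse]) auto
qed

lemma smooth_on_has_derivative:
  fixes f :: "'a::euclidean_space \<Rightarrow> 'b::euclidean_space"
  assumes "open S" "x \<in> S" "smooth_on S f"
  shows "(f has_derivative (\<lambda>h. \<Sum>v\<in>Basis. (h \<bullet> v) *\<^sub>R pd v f x)) (at x)"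
  unfolding has_derivative_componentwise_within[of f]
proof
  fix b :: 'b assume b: "b \<in> Basis"
  have "smooth_on S (\<lambda>x. f x \<bullet> b)" using assms(3) b unfolding smooth_on_componentwise[OF assms(1), of f] by blast
  then have *: "C_on (Suc 0) S (\<lambda>x. f x \<bullet> b)" by (rule smooth_on_imp_C_on)
  have "pd v (\<lambda>x. f x \<bullet> b) x = pd v f x \<bullet> b" if "v \<in> Basis" for v
    by (intro has_partial_imp_pd has_partial_inner smooth_on_partial[OF assms(3) that assms(2)])
  then show "((\<lambda>x. f x \<bullet> b) has_derivative (\<lambda>h. (\<Sum>v\<in>Basis. (h \<bullet> v) *\<^sub>R pd v f x) \<bullet> b)) (at x)"
    using C_on_has_derivative[OF assms(1,2) *] by (simp add: inner_sum_left)
qed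

text \<open>Bootstrap for inverse maps: their partial derivatives are smooth functions of the map's
  own values, so if \<open>g\<close> has class k, its partial derivatives have class k and
  \<open>g\<close> has class k + 1.\<close>

lemma smooth_on_if_partials_factor:
  fixes g :: "'a::euclidean_space \<Rightarrow> 'b::euclidean_space"
  assumes "open U" "open V" "g ` V \<subseteq> U" "continuous_on V g"
    and M: "\<And>v. v \<in> Basis \<Longrightarrow> smooth_on U (M v)"
    and part: "\<And>v y. v \<in> Basis \<Longrightarrow> y \<in> V \<Longrightarrow> has_partial v g (M v (g y)) y"
  shows "smooth_on V g"
proof -
  have "C_on k V g" for k
  proof (induction k)
    case (Suc k)
    have "C_on k V (\<lambda>y. M v (g y))" if "v \<in> Basis" for v
      unfolding C_on_componentwise[of _ _ "\<lambda>y. M v (g y)"]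
    proof
      fix b :: 'b assume "b \<in> Basis"
      then have "C_on k U (\<lambda>x. M v x \<bullet> b)"
        using smooth_on_imp_C_on[OF M[OF that], of k] unfolding C_on_componentwise[of _ _ "M v"] by blast
      then show "C_on k V (\<lambda>y. M v (g y) \<bullet> b)"
        by (rule C_on_compose[OF assms(1-3)]) (rule Suc)
    qed
    then show ?case using assms(4) part by auto
  qed (use assms(4) in simp)
  then show ?thesis using smooth_on_iff_C_on[OF assms(2)] by blast
qed

section \<open>Taylor jets and flat functions\<close>

lemma has_partial_one_iff:
  fixes f :: "real \<Rightarrow> 'b::real_normed_vector"
  shows "has_partial 1 f d x \<longleftrightarrow> (f has_vector_derivative d) (at x)"
proof
  assume "has_partial 1 f d x"
  then have "((\<lambda>t. f (x + t)) has_vector_derivative d) (at (x - x))" by (simp add: has_partial_def)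
  then have "((\<lambda>t. f (x + t)) \<circ> (\<lambda>y. y - x) has_vector_derivative 1 *\<^sub>R d) (at x)"
    by (intro vector_diff_chain_at) (auto intro!: derivative_eq_intros)
  then show "(f has_vector_derivative d) (at x)" by (simp add: o_def)
next
  assume "(f has_vector_derivative d) (at x)"
  then have "(f has_vector_derivative d) (at (x + 0))" by simp
  then have "(f \<circ> (\<lambda>y. x + y) has_vector_derivative 1 *\<^sub>R d) (at 0)"
    by (intro vector_diff_chain_at) (auto intro!: derivative_eq_intros)
  then show "has_partial 1 f d x" by (simp add: o_def has_partial_def)
qed

lemma cderiv_0 [simp]: "cderiv 0 f = f"
  by (simp add: cderiv_def)

lemma cderiv_Suc: "cderiv (Suc k) f = pd 1 (cderiv k f)"
  by (simp add: cderiv_def)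

lemma cderiv_pd: "cderiv k (pd 1 f) = cderiv (Suc k) f"
  by (induction k) (simp_all add: cderiv_Suc)

lemma smooth_on_cderiv: "smooth_on S f \<Longrightarrow> smooth_on S (cderiv k f)"
  by (induction k) (simp_all add: cderiv_Suc smooth_on_pd)

lemma smooth_on_cderiv_has_vector_derivative:
  "smooth_on S f \<Longrightarrow> x \<in> S \<Longrightarrow> (cderiv k f has_vector_derivative cderiv (Suc k) f x) (at x)"
  unfolding cderiv_Suc has_partial_one_iff[symmetric]
  by (rule smooth_on_partial[OF smooth_on_cderiv]) simp_all

lemma smooth_on_cderiv_DERIV:
  fixes f :: "real \<Rightarrow> real"
  shows "smooth_on S f \<Longrightarrow> x \<in> S \<Longrightarrow> (cderiv k f has_real_derivative cderiv (Suc k) f x) (at x)"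
  unfolding has_real_derivative_iff_has_vector_derivative by (rule smooth_on_cderiv_has_vector_derivative)

text \<open>Serves functions given by a series, where candidates for all derivatives are known
  termwise before smoothness is.\<close>

lemma smooth_on_of_DERIV_seq:
  fixes D :: "nat \<Rightarrow> real \<Rightarrow> real"
  assumes "open S" and D: "\<And>k x. x \<in> S \<Longrightarrow> (D k has_real_derivative D (Suc k) x) (at x)"
  shows "smooth_on S (D 0)" and "\<And>k x. x \<in> S \<Longrightarrow> cderiv k (D 0) x = D k x"
proof -
  have part: "has_partial 1 (D k) (D (Suc k) x) x" if "x \<in> S" for k x
    using D[OF that] by (simp add: has_partial_one_iff has_real_derivative_iff_has_vector_derivative)
  have cont: "continuous_on S (D k)" for k
    using D by (meson DERIV_continuous continuous_at_imp_continuous_on)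
  have "C_on n S (D k)" for n k
  proof (induction n arbitrary: k)
    case (Suc n)
    then have "\<exists>g. C_on n S g \<and> (\<forall>x\<in>S. has_partial 1 (D k) (g x) x)"
      using part by (intro exI[of _ "D (Suc k)"]) simp
    then show ?case using cont by simp
  qed (use cont in simp)
  then show "smooth_on S (D 0)" using smooth_on_iff_C_on[OF assms(1)] by blast
  show "cderiv k (D 0) x = D k x" if "x \<in> S" for k x
    using that
  proof (induction k arbitrary: x)
    case (Suc k)
    then have "has_partial 1 (cderiv k (D 0)) (D (Suc k) x) x"
      using has_partial_cong[OF assms(1) \<open>x \<in> S\<close>, of "cderiv k (D 0)" "D k"] part by blast
    then show ?case by (simp add: cderiv_Suc has_partial_imp_pd)
  qed simp
qed

text \<open>Only coefficients of degree below \<open>N\<close> matter, so jets of length 8 and 12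
  are the ones that show orders 7 and 11. The estimate lives on a punctured neighbourhood; for N > 0
  the constant term is the limit at 0.\<close>

definition has_jet :: "nat \<Rightarrow> (real \<Rightarrow> real) \<Rightarrow> (nat \<Rightarrow> real) \<Rightarrow> bool" where
  "has_jet N f c \<longleftrightarrow> (\<lambda>u. f u - (\<Sum>k<N. c k * u ^ k)) \<in> O[at 0](\<lambda>u. u ^ N)"

lemma smooth_on_has_jet:
  fixes f :: "real \<Rightarrow> real"
  assumes S: "open S" "0 \<in> S" and f: "smooth_on S f"
  shows "has_jet N f (\<lambda>k. cderiv k f 0 / fact k)"
proof -
  obtain r where r: "r > 0" "cball 0 r \<subseteq> S" using S open_contains_cball by blast
  have "compact (cderiv N f ` cball 0 r)"
    using smooth_on_continuous[OF smooth_on_cderiv[OF f]] r(2)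
    by (intro compact_continuous_image) (auto intro: continuous_on_subset)
  then obtain M where M: "\<And>t. t \<in> cball 0 r \<Longrightarrow> \<bar>cderiv N f t\<bar> \<le> M"
    using compact_imp_bounded[THEN bounded_imp_bdd_above] compact_imp_bounded
    by (metis bounded_iff image_eqI real_norm_def)
  have "norm (f u - (\<Sum>k<N. cderiv k f 0 / fact k * u ^ k)) \<le> M / fact N * norm (u ^ N)"
    if u: "\<bar>u\<bar> \<le> r" "u \<noteq> 0" for u
  proof -
    have "\<exists>t. \<bar>t\<bar> \<le> r \<and> f u = (\<Sum>k<N. cderiv k f 0 / fact k * u ^ k) + cderiv N f t / fact N * u ^ N"
    \<comment> \<open>\<open>Taylor\<close> requires a positive order; for N = 0 the point t = u
      itself serves.\<close>
    proof (cases "N = 0")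
      case True
      with u show ?thesis by auto
    next
      case False
      have "\<forall>m t. m < N \<and> - r \<le> t \<and> t \<le> r \<longrightarrow> DERIV (cderiv m f) t :> cderiv (Suc m) f t"
        using r(2) by (auto intro!: smooth_on_cderiv_DERIV[OF f] simp: subset_iff)
      then have "\<exists>t. (if u < 0 then u < t \<and> t < 0 else 0 < t \<and> t < u) \<and>
         f u = (\<Sum>m<N. cderiv m f 0 / fact m * (u - 0) ^ m) + cderiv N f t / fact N * (u - 0) ^ N"
        using u r(1) False by (intro Taylor[of N "\<lambda>k. cderiv k f" f "-r" r]) auto
      then obtain t where "if u < 0 then u < t \<and> t < 0 else 0 < t \<and> t < u"
         "f u = (\<Sum>m<N. cderiv m f 0 / fact m * u ^ m) + cderiv N f t / fact N * u ^ N" by auto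
      then show ?thesis using u by (intro exI[of _ t]) (auto split: if_splits)
    qed
    then obtain t where t: "\<bar>t\<bar> \<le> r" "f u = (\<Sum>k<N. cderiv k f 0 / fact k * u ^ k) + cderiv N f t / fact N * u ^ N"
      by blast
    have "\<bar>cderiv N f t\<bar> \<le> M" using M t(1) by auto
    then have "\<bar>cderiv N f t / fact N\<bar> * \<bar>u ^ N\<bar> \<le> M / fact N * \<bar>u ^ N\<bar>"
      by (intro mult_right_mono) (auto simp: divide_right_mono)
    with t(2) show ?thesis by (simp add: abs_mult[symmetric] del: abs_divide)
  qed
  moreover have "\<forall>\<^sub>F u in at (0::real). \<bar>u\<bar> \<le> r \<and> u \<noteq> 0"
    unfolding eventually_at using r(1) by (intro exI[of _ r]) auto
  ultimately show ?thesis
    unfolding has_jet_def by (intro bigoI[of _ "M / fact N"]) (auto elim!: eventually_mono)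
qed

lemma bigo_imp_tendsto_0:
  fixes f g :: "real \<Rightarrow> real"
  assumes "f \<in> O[F](g)" "(g \<longlongrightarrow> 0) F"
  shows "(f \<longlongrightarrow> 0) F"
proof -
  obtain c where "\<forall>\<^sub>F x in F. norm (f x) \<le> c * norm (g x)"
    using assms(1) by (auto simp: bigo_def)
  moreover have "((\<lambda>x. c * norm (g x)) \<longlongrightarrow> c * norm (0::real)) F"
    by (intro tendsto_intros assms(2))
  ultimately show ?thesis by (intro Lim_null_comparison[of f "\<lambda>x. c * norm (g x)"]) simp_all
qed

text \<open>Letting u tend to 0 kills the constant coefficient; then a factor u cancels on both
  sides.\<close>

lemma polynomial_bigo_imp_zero:
  fixes d :: "nat \<Rightarrow> real"
  assumes "(\<lambda>u. \<Sum>k<N. d k * u ^ k) \<in> O[at 0](\<lambda>u. u ^ N)" "k < N"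
  shows "d k = 0"
  using assms
proof (induction N arbitrary: d k)
  case (Suc N)
  have split: "(\<Sum>k<Suc N. d k * u ^ k) = d 0 + u * (\<Sum>k<N. d (Suc k) * u ^ k)" for u
    by (subst sum.lessThan_Suc_shift) (simp add: sum_distrib_left algebra_simps)
  have 0: "((\<lambda>u::real. u ^ Suc N) \<longlongrightarrow> 0 ^ Suc N) (at 0)" by (intro tendsto_intros)
  have "((\<lambda>u. d 0 + u * (\<Sum>k<N. d (Suc k) * u ^ k)) \<longlongrightarrow> 0) (at 0)"
    using bigo_imp_tendsto_0[OF Suc.prems(1)] 0 unfolding split by simp
  moreover have "((\<lambda>u. d 0 + u * (\<Sum>k<N. d (Suc k) * u ^ k)) \<longlongrightarrow> d 0 + 0 * (\<Sum>k<N. d (Suc k) * 0 ^ k)) (at 0)"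
    by (intro tendsto_intros)
  ultimately have d0: "d 0 = 0" using tendsto_unique[OF trivial_limit_at[of 0]] by force
  have "(\<lambda>u. u * (\<Sum>k<N. d (Suc k) * u ^ k)) \<in> O[at 0](\<lambda>u. u * u ^ N)"
    using Suc.prems(1) unfolding split d0 by simp
  then have "(\<lambda>u. \<Sum>k<N. d (Suc k) * u ^ k) \<in> O[at 0](\<lambda>u. u ^ N)"
    by (subst (asm) landau_o.big.mult_cancel_left) (auto simp: eventually_at_filter)
  then have "d (Suc j) = 0" if "j < N" for j using Suc.IH[of "\<lambda>k. d (Suc k)" j] that by simp
  with d0 Suc.prems(2) show ?case by (cases k) simp_all
qed blast

lemma has_jet_unique:
  assumes "has_jet N f c" "has_jet N f d" "k < N"
  shows "c k = d k"
proof -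
  have "(\<lambda>u. (f u - (\<Sum>k<N. d k * u ^ k)) - (f u - (\<Sum>k<N. c k * u ^ k))) \<in> O[at 0](\<lambda>u. u ^ N)"
    using assms(1,2) unfolding has_jet_def by (rule sum_in_bigo(2)[rotated])
  moreover have "(f u - (\<Sum>k<N. d k * u ^ k)) - (f u - (\<Sum>k<N. c k * u ^ k)) = (\<Sum>k<N. (c k - d k) * u ^ k)" for u
    by (simp add: left_diff_distrib sum_subtractf)
  ultimately show ?thesis using polynomial_bigo_imp_zero[of "\<lambda>k. c k - d k" N k] assms(3) by simp
qed

text \<open>Derivatives of composed curves are obtained in this manner: a jet found by polynomial
  arithmetic replaces a formula for higher derivatives of compositions.\<close>

lemma cderiv_eq_if_has_jet:
  assumes "open S" "0 \<in> S" "smooth_on S f" "has_jet N f c" "k < N"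
  shows "cderiv k f 0 = fact k * c k"
  using has_jet_unique[OF smooth_on_has_jet[OF assms(1-3)] assms(4,5)] by (simp add: field_simps)

section \<open>Flat functions and the substitution of a fourth root\<close>

definition flat :: "(real \<Rightarrow> real) \<Rightarrow> bool" where
  "flat f \<longleftrightarrow> (\<forall>N. f \<in> O[at 0](\<lambda>u. u ^ N))"

lemma flat_iff_has_jet_0: "flat f \<longleftrightarrow> (\<forall>N. has_jet N f (\<lambda>k. 0))"
  by (simp add: flat_def has_jet_def)

lemma flat_iff_cderiv:
  assumes "open S" "0 \<in> S" "smooth_on S f"
  shows "flat f \<longleftrightarrow> (\<forall>k. cderiv k f 0 = 0)"
proof
  assume "flat f"
  then show "\<forall>k. cderiv k f 0 = 0"
    using cderiv_eq_if_has_jet[OF assms] unfolding flat_iff_has_jet_0 by (metis lessI mult_zero_right)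
next
  assume "\<forall>k. cderiv k f 0 = 0"
  then show "flat f"
    using smooth_on_has_jet[OF assms] by (simp add: flat_iff_has_jet_0)
qed

text \<open>A growth estimate alone says nothing about the derivative; smoothness turns flatness
  into the vanishing of all derivatives at 0, which \<open>pd 1 f\<close> inherits.\<close>

lemma flat_pd:
  assumes "open S" "0 \<in> S" "smooth_on S f" "flat f"
  shows "flat (pd 1 f)"
  using assms flat_iff_cderiv[OF assms(1-3)] flat_iff_cderiv[OF assms(1,2) smooth_on_pd[OF assms(3)]]
  by (simp add: cderiv_pd)

lemma flat_tendsto_0:
  assumes "flat f"
  shows "((\<lambda>u. f u / u ^ m) \<longlongrightarrow> 0) (at 0)"
proof -
  have "f \<in> O[at 0](\<lambda>u. u ^ Suc m)" using assms unfolding flat_def by blast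
  then have "(\<lambda>u. f u / u ^ m) \<in> O[at 0](\<lambda>u. u ^ Suc m / u ^ m)"
    by (rule landau_o.big.divide_right[rotated])
      (rule eventually_mono[OF eventually_neq_at_within[of "0::real" 0 UNIV]], simp)
  moreover have "((\<lambda>u::real. u ^ Suc m / u ^ m) \<longlongrightarrow> 0) (at 0)"
    by (rule Lim_transform_eventually[OF tendsto_ident_at]) (auto simp: eventually_at_filter)
  ultimately show ?thesis by (rule bigo_imp_tendsto_0)
qed

text \<open>For flat \<open>f\<close> the functions \<open>root4 f m\<close> are smooth because their class is closed under differentiation.\<close>

definition root4 :: "(real \<Rightarrow> real) \<Rightarrow> nat \<Rightarrow> real \<Rightarrow> real" where
  "root4 f m s = (if s > 0 then f (root 4 s) / root 4 s ^ m else 0)"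

text \<open>With s = t^4 one has d/ds = 1/(4 t^3) d/dt, so f/t^m becomes (t f' - m f)/(4 t^(m+4)),
  an expression of the same shape. Flatness joins this branch to the constant 0 on s \<le>
  0.\<close>

lemma root4_DERIV:
  fixes f :: "real \<Rightarrow> real"
  assumes r: "r > 0" and f: "smooth_on {-r<..<r} f" "flat f" and s: "s \<in> {-(r^4)<..<r^4}"
  shows "(root4 f m has_real_derivative root4 (\<lambda>t. (t * pd 1 f t - real m * f t) * (1/4)) (m + 4) s) (at s)"
proof -
  let ?g = "\<lambda>t. (t * pd 1 f t - real m * f t) * (1/4)"
  consider "s < 0" | "s = 0" | "s > 0" by linarith
  then show ?thesis
  proof cases
    case 1
    have "\<forall>\<^sub>F x in nhds s. x < 0" using 1 by (intro eventually_nhds_in_open[of "{..<0}", simplified]) auto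
    then have "\<forall>\<^sub>F x in nhds s. root4 f m x = 0" by eventually_elim (simp add: root4_def)
    then show ?thesis using 1 by (subst DERIV_cong_ev[OF refl _ refl]) (auto simp: root4_def)
  next
    \<comment> \<open>For s = t^4 > 0 the difference quotient is f(t)/t^(m+4), which tends to 0
      because \<open>f\<close> is flat.\<close>
    case 2
    have "((\<lambda>t. f t / t ^ (m + 4)) \<longlongrightarrow> 0) (at 0)" by (rule flat_tendsto_0[OF f(2)])
    moreover have "filterlim (root 4) (at 0) (at_right 0)"
    proof (rule filterlim_atI)
      have "(root 4 \<longlongrightarrow> root 4 0) (at 0)" by (intro tendsto_intros)
      then show "(root 4 \<longlongrightarrow> 0) (at_right 0)" by (simp add: filterlim_at_split)
      show "\<forall>\<^sub>F x in at_right 0. root 4 x \<noteq> 0" by (auto simp: eventually_at_filter)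
    qed
    ultimately have "((\<lambda>s. f (root 4 s) / root 4 s ^ (m + 4)) \<longlongrightarrow> 0) (at_right 0)"
      by (rule filterlim_compose)
    then have "((\<lambda>s. root4 f m s / s) \<longlongrightarrow> 0) (at_right 0)"
      by (rule Lim_transform_eventually) (auto simp: eventually_at_filter root4_def power_add)
    moreover have "((\<lambda>s. root4 f m s / s) \<longlongrightarrow> 0) (at_left 0)"
      by (rule Lim_transform_eventually[OF tendsto_const]) (auto simp: eventually_at_filter root4_def)
    ultimately have "((\<lambda>s. root4 f m s / s) \<longlongrightarrow> 0) (at 0)" by (simp add: filterlim_at_split)
    then show ?thesis using 2 by (simp add: has_field_derivative_iff root4_def)
  next
    case 3
    define t where "t = root 4 s"
    have t: "t > 0" "t ^ 4 = s" using 3 by (simp_all add: t_def)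
    have "t < r" using s t r by (metis greaterThanLessThan_iff power_less_imp_less_base less_imp_le)
    then have "(f has_real_derivative pd 1 f t) (at t)"
      using smooth_on_cderiv_DERIV[OF f(1), of t 0] t(1) r by (simp add: cderiv_Suc)
    moreover have "(root 4 has_real_derivative inverse (real 4 * t ^ (4 - Suc 0))) (at s)"
      unfolding t_def by (rule DERIV_real_root) (use 3 in auto)
    then have root: "(root 4 has_real_derivative 1 / (4 * t ^ 3)) (at s)" by (simp add: field_simps)
    ultimately have "((\<lambda>s. f (root 4 s)) has_real_derivative pd 1 f t * (1 / (4 * t ^ 3))) (at s)"
      unfolding t_def by (intro DERIV_chain2[of f])
    from DERIV_divide[OF this DERIV_power[OF root, of m]]
    have "((\<lambda>s. f (root 4 s) / root 4 s ^ m) has_real_derivative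
       (pd 1 f t * (1 / (4 * t ^ 3)) * t ^ m - f t * (real m * (1 / (4 * t ^ 3) * t ^ (m - Suc 0)))) / (t ^ m * t ^ m)) (at s)"
      using t(1) by (simp add: t_def)
    moreover have "(pd 1 f t * (1 / (4 * t ^ 3)) * t ^ m - f t * (real m * (1 / (4 * t ^ 3) * t ^ (m - Suc 0)))) / (t ^ m * t ^ m)
        = root4 ?g (m + 4) s"
    proof -
      have "root4 ?g (m + 4) s = ?g t / (t ^ m * t ^ 4)"
        using 3 by (simp add: root4_def t_def power_add)
      moreover have "t ^ 4 = t * t ^ 3" by (simp add: power_numeral_reduce)
      ultimately have "root4 ?g (m + 4) s = ?g t / (t ^ m * (t * t ^ 3))" by (simp only:)
      moreover have "(pd 1 f t * (1 / (4 * t ^ 3)) * t ^ m - f t * (real m * (1 / (4 * t ^ 3) * t ^ (m - Suc 0)))) / (t ^ m * t ^ m)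
          = ?g t / (t ^ m * (t * t ^ 3))"
        using t(1) by (cases m) (simp_all add: divide_simps, simp add: algebra_simps)
      ultimately show ?thesis by (simp only:)
    qed
    ultimately have "((\<lambda>s. f (root 4 s) / root 4 s ^ m) has_real_derivative root4 ?g (m + 4) s) (at s)"
      by simp
    moreover have "\<forall>\<^sub>F x in nhds s. 0 < x" using 3 by (intro eventually_nhds_in_open[of "{0<..}", simplified]) auto
    then have "\<forall>\<^sub>F x in nhds s. f (root 4 x) / root 4 x ^ m = root4 f m x" by eventually_elim (simp add: root4_def)
    ultimately show ?thesis by (subst (asm) DERIV_cong_ev[OF refl _ refl])
  qed
qed

lemma smooth_on_root4:
  fixes f :: "real \<Rightarrow> real"
  assumes r: "r > 0" and f: "smooth_on {-r<..<r} f" "flat f"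
  shows "smooth_on {-(r^4)<..<r^4} (root4 f m)"
proof -
  have "C_on n {-(r^4)<..<r^4} (root4 f m)" for n
    using f
  proof (induction n arbitrary: f m)
    case 0
    show ?case unfolding C_on.simps using root4_DERIV[OF r 0, THEN DERIV_isCont]
      by (intro continuous_at_imp_continuous_on ballI)
  next
    case (Suc n)
    let ?g = "\<lambda>t. (t * pd 1 f t - real m * f t) * (1/4)"
    have g: "smooth_on {-r<..<r} ?g"
      by (intro smooth_on_minus smooth_on_mult smooth_on_const smooth_on_ident_real smooth_on_pd Suc.prems) auto
    have "flat (pd 1 f)" using flat_pd[OF _ _ Suc.prems] r by auto
    \<comment> \<open>The new numerator is flat again, so the induction hypothesis applies to it
      with exponent \<open>m + 4\<close>.\<close>
    have "?g \<in> O[at 0](\<lambda>u. u ^ N)" for N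
    proof -
      have "pd 1 f \<in> O[at 0](\<lambda>u. u ^ N)" "f \<in> O[at 0](\<lambda>u. u ^ N)"
        using \<open>flat (pd 1 f)\<close> Suc.prems(2) by (simp_all add: flat_def)
      moreover have "(\<lambda>u::real. u) \<in> O[at 0](\<lambda>u. 1)"
        by (intro bigoI_tendsto[of _ _ 0]) (auto intro!: tendsto_intros)
      ultimately have "(\<lambda>u. u * pd 1 f u - real m * f u) \<in> O[at 0](\<lambda>u. u ^ N)"
        using landau_o.big.mult[of "\<lambda>u. u" "at 0" "\<lambda>u. 1" "pd 1 f" "\<lambda>u. u ^ N"]
        by (intro sum_in_bigo) auto
      then show ?thesis by simp
    qed
    then have "flat ?g" by (simp add: flat_def)
    then have "C_on n {-(r^4)<..<r^4} (root4 ?g (m + 4))" by (rule Suc.IH[OF g])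
    moreover have "\<forall>x\<in>{-(r^4)<..<r^4}. has_partial 1 (root4 f m) (root4 ?g (m + 4) x) x"
      using root4_DERIV[OF r Suc.prems]
      by (simp add: has_partial_one_iff has_real_derivative_iff_has_vector_derivative)
    moreover have "continuous_on {-(r^4)<..<r^4} (root4 f m)"
      using root4_DERIV[OF r Suc.prems, THEN DERIV_isCont] by (intro continuous_at_imp_continuous_on ballI)
    ultimately have "\<exists>g. C_on n {-(r^4)<..<r^4} g \<and> (\<forall>x\<in>{-(r^4)<..<r^4}. has_partial 1 (root4 f m) (g x) x)"
      "continuous_on {-(r^4)<..<r^4} (root4 f m)" by blast+
    then show ?case by simp
  qed
  then show ?thesis by (simp add: smooth_on_iff_C_on)
qed

section \<open>Borel's lemma and functions of the fourth and fifth powers\<close>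

text \<open>
  \<open>sincos k a b\<close> is the \<open>k\<close>-th derivative of \<open>sin^a * cos^b\<close>. In Borel's lemma, \<open>sin^n\<close> replaces the
  usual cut-off power: all its derivatives are bounded and its jet starts with \<open>s^n\<close>, so the
  coefficients \<open>c\<close> of the series of \<open>c / l^n * sin^n (l * s)\<close> can be chosen recursively, with scales
  \<open>l\<close> so large that all differentiated series converge uniformly.
\<close>

fun sincos :: "nat \<Rightarrow> nat \<Rightarrow> nat \<Rightarrow> real \<Rightarrow> real" where
  "sincos 0 a b u = sin u ^ a * cos u ^ b"
| "sincos (Suc k) a b u = real a * sincos k (a - 1) (b + 1) u - real b * sincos k (a + 1) (b - 1) u"

lemma sincos_DERIV: "(sincos k a b has_real_derivative sincos (Suc k) a b u) (at u)"
proof (induction k arbitrary: a b)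
  case 0
  have "((\<lambda>u. sin u ^ a * cos u ^ b) has_real_derivative
     (real a * (cos u * sin u ^ (a - Suc 0))) * cos u ^ b + (real b * (- sin u * cos u ^ (b - Suc 0))) * sin u ^ a) (at u)"
    by (rule DERIV_mult) (rule DERIV_power DERIV_sin DERIV_cos)+
  moreover have "sincos 0 a b = (\<lambda>u. sin u ^ a * cos u ^ b)" by (simp add: fun_eq_iff)
  ultimately show ?case by (simp add: algebra_simps)
next
  case (Suc k)
  have eq: "sincos (Suc k) a b = (\<lambda>u. real a * sincos k (a - 1) (b + 1) u - real b * sincos k (a + 1) (b - 1) u)"
    by (simp add: fun_eq_iff)
  show ?case unfolding eq sincos.simps(2)[of "Suc k"]
    by (intro DERIV_diff DERIV_cmult Suc)
qed

text \<open>One differentiation turns a monomial of degree a + b in sine and cosine into monomials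
  of the same degree with total weight a + b. Truncated subtraction does no harm, since the
  coefficient is 0 in that case.\<close>

lemma sincos_bound: "\<bar>sincos k a b u\<bar> \<le> real (a + b) ^ k"
proof (induction k arbitrary: a b)
  case 0
  have "\<bar>sin u ^ a\<bar> * \<bar>cos u ^ b\<bar> \<le> 1 * 1"
    by (intro mult_mono) (auto simp: power_abs power_le_one)
  then show ?case by (simp add: abs_mult)
next
  case (Suc k)
  have "\<bar>real a * sincos k (a - 1) (b + 1) u\<bar> \<le> real a * real (a + b) ^ k"
    unfolding abs_mult using Suc[of "a - 1" "b + 1"] by (cases a) (auto intro!: mult_left_mono)
  moreover have "\<bar>real b * sincos k (a + 1) (b - 1) u\<bar> \<le> real b * real (a + b) ^ k"
    unfolding abs_mult using Suc[of "a + 1" "b - 1"] by (cases b) (auto intro!: mult_left_mono)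
  ultimately show ?case
    using abs_triangle_ineq4[of "real a * sincos k (a - 1) (b + 1) u" "real b * sincos k (a + 1) (b - 1) u"]
    by (simp add: distrib_right)
qed

text \<open>The power sin^a vanishes to order a with leading coefficient 1. In the recursion the
  branch with exponent a + 1 vanishes at 0, which leaves a times the value for a - 1.\<close>

lemma sincos_at_0: "k \<le> a \<Longrightarrow> sincos k a b 0 = (if k = a then fact a else 0)"
proof (induction k arbitrary: a b)
  case (Suc k)
  then obtain a' where a: "a = Suc a'" by (cases a) auto
  with Suc.prems have "k \<le> a'" "k \<le> Suc (Suc a')" "k \<noteq> Suc (Suc a')" by auto
  then show ?case using Suc.IH[of a' "b + 1"] Suc.IH[of "Suc (Suc a')" "b - 1"] by (simp add: a)
qed simp

text \<open>For k < n the k-th derivative of the n-th term is at most |c| n^n / l: n^n bounds the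
  derivative of sin^n, and at least one factor 1/l survives. This l pushes it below 2^(-n); the
  summand 1 keeps l \<ge> 1.\<close>

definition borel_scale :: "nat \<Rightarrow> real \<Rightarrow> real" where
  "borel_scale n c = 1 + \<bar>c\<bar> * real n ^ n * 2 ^ n"

definition borel_term :: "nat \<Rightarrow> nat \<Rightarrow> real \<Rightarrow> real \<Rightarrow> real" where
  "borel_term k n c s = c * borel_scale n c ^ k / borel_scale n c ^ n * sincos k n 0 (borel_scale n c * s)"

text \<open>A triangular system: the n-th derivative at 0 sees only the terms m \<le> n, and term n
  contributes \<open>c * fact n\<close> because l^n cancels. Hence the scale may depend on the
  coefficient without circularity.\<close>

fun borel_coeff :: "(nat \<Rightarrow> real) \<Rightarrow> nat \<Rightarrow> real" where
  "borel_coeff a n = (a n - (\<Sum>m<n. borel_term n m (borel_coeff a m) 0)) / fact n"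

declare borel_coeff.simps [simp del]

lemma borel_scale_ge_1: "borel_scale n c \<ge> 1"
  by (simp add: borel_scale_def)

lemma borel_term_DERIV: "(borel_term k n c has_real_derivative borel_term (Suc k) n c s) (at s)"
proof -
  have "((\<lambda>s. sincos k n 0 (borel_scale n c * s)) has_real_derivative
      sincos (Suc k) n 0 (borel_scale n c * s) * borel_scale n c) (at s)"
    by (rule DERIV_chain2[OF sincos_DERIV]) (auto intro!: derivative_eq_intros)
  from DERIV_cmult[OF this, of "c * borel_scale n c ^ k / borel_scale n c ^ n"]
  show ?thesis unfolding borel_term_def by (simp add: mult_ac del: sincos.simps)
qed

lemma borel_term_bound:
  assumes "k < n"
  shows "\<bar>borel_term k n c s\<bar> \<le> (1 / 2) ^ n"
proof -
  let ?l = "borel_scale n c"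
  have l: "?l \<ge> 1" by (rule borel_scale_ge_1)
  have "\<bar>c\<bar> * real n ^ n * 2 ^ n \<le> ?l" by (simp add: borel_scale_def)
  then have "\<bar>c\<bar> * real n ^ n \<le> ?l * (1 / 2) ^ n" by (simp add: field_simps power_one_over)
  also have "\<dots> \<le> ?l ^ (n - k) * (1 / 2) ^ n"
    using l assms by (intro mult_right_mono self_le_power) auto
  finally have 1: "\<bar>c\<bar> * real n ^ n \<le> ?l ^ (n - k) * (1 / 2) ^ n" .
  have "\<bar>sincos k n 0 (?l * s)\<bar> \<le> real n ^ k" using sincos_bound[of k n 0] by simp
  also have "\<dots> \<le> real n ^ n" using assms by (intro power_increasing) auto
  finally have "\<bar>c\<bar> * \<bar>sincos k n 0 (?l * s)\<bar> \<le> \<bar>c\<bar> * real n ^ n" by (rule mult_left_mono) simp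
  with 1 have "\<bar>c\<bar> * \<bar>sincos k n 0 (?l * s)\<bar> \<le> ?l ^ (n - k) * (1 / 2) ^ n" by linarith
  moreover have "\<bar>borel_term k n c s\<bar> = \<bar>c\<bar> * \<bar>sincos k n 0 (?l * s)\<bar> / ?l ^ (n - k)"
  proof -
    have "?l ^ n = ?l ^ k * ?l ^ (n - k)" using assms by (simp flip: power_add)
    then show ?thesis using l by (simp add: borel_term_def abs_mult)
  qed
  ultimately show ?thesis using l by (simp add: divide_le_eq mult.commute)
qed

lemma borel_lemma: "\<exists>B::real \<Rightarrow> real. smooth_on UNIV B \<and> (\<forall>k. cderiv k B 0 = a k)"
proof -
  define c where "c = borel_coeff a"
  define D where "D k s = (\<Sum>n. borel_term k n (c n) s)" for k s
  \<comment> \<open>The geometric bound starts only at n > k, hence the eventual forms of the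
    comparison tests.\<close>
  have ev: "\<forall>\<^sub>F n in sequentially. \<forall>s. norm (borel_term k n (c n) s) \<le> (1 / 2) ^ n" for k
    using eventually_gt_at_top[of k] by eventually_elim (simp add: borel_term_bound)
  have unif: "uniformly_convergent_on UNIV (\<lambda>n s. \<Sum>i<n. borel_term k i (c i) s)" for k
  proof -
    have "\<forall>\<^sub>F n in sequentially. \<forall>s\<in>UNIV. norm (borel_term k n (c n) s) \<le> (1 / 2) ^ n" using ev[of k] by simp
    from Weierstrass_m_test_ev[OF this] show ?thesis by (auto simp: uniformly_convergent_on_def)
  qed
  have summ: "summable (\<lambda>n. borel_term k n (c n) s)" for k s
  proof -
    have "\<forall>\<^sub>F n in sequentially. norm (borel_term k n (c n) s) \<le> (1 / 2) ^ n"
      using ev[of k] by (rule eventually_mono) blast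
    from summable_comparison_test_ev[OF this] show ?thesis by simp
  qed
  have D: "(D k has_real_derivative D (Suc k) s) (at s)" for k s
    unfolding D_def
    by (rule has_field_derivative_series'(2)[OF convex_UNIV borel_term_DERIV unif UNIV_I summ]) simp
  have "D k 0 = a k" for k
  proof -
    \<comment> \<open>The terms with n > k vanish at 0 to an order higher than k, so the series
      becomes finite.\<close>
    have "D k 0 = (\<Sum>n\<le>k. borel_term k n (c n) 0)"
      unfolding D_def by (rule suminf_finite) (auto simp: borel_term_def sincos_at_0)
    also have "\<dots> = (\<Sum>n<k. borel_term k n (c n) 0) + c k * fact k"
      using borel_scale_ge_1[of k "c k"] by (simp add: lessThan_Suc_atMost[symmetric] borel_term_def sincos_at_0)
    also have "\<dots> = a k" by (simp add: c_def borel_coeff.simps[of a k])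
    finally show ?thesis .
  qed
  with smooth_on_of_DERIV_seq[of UNIV D] D show ?thesis by (intro exI[of _ "D 0"]) simp
qed

section \<open>Functions whose Taylor exponents lie in the semigroup of 4 and 5\<close>

lemma power_bigo_power: "m \<le> n \<Longrightarrow> (\<lambda>u::real. u ^ n) \<in> O[at 0](\<lambda>u. u ^ m)"
proof (rule bigoI[of _ 1])
  assume "m \<le> n"
  have "\<forall>\<^sub>F u in at (0::real). \<bar>u\<bar> \<le> 1" unfolding eventually_at by (intro exI[of _ 1]) auto
  then show "\<forall>\<^sub>F u in at (0::real). norm (u ^ n) \<le> 1 * norm (u ^ m)"
    by eventually_elim (use \<open>m \<le> n\<close> in \<open>simp add: power_abs power_decreasing\<close>)
qed

text \<open>The factor u^j is bounded near 0, which gives the same error order for each of the four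
  progressions of exponents.\<close>

lemma has_jet_power4_bigo:
  assumes "has_jet N B d"
  shows "(\<lambda>u. u ^ j * B (u ^ 4) - (\<Sum>n<N. d n * u ^ (4 * n + j))) \<in> O[at 0](\<lambda>u. u ^ (4 * N))"
proof -
  have "filterlim (\<lambda>u::real. u ^ 4) (at 0) (at 0)"
  proof (rule filterlim_atI)
    have "((\<lambda>u::real. u ^ 4) \<longlongrightarrow> 0 ^ 4) (at 0)" by (intro tendsto_intros)
    then show "((\<lambda>u::real. u ^ 4) \<longlongrightarrow> 0) (at 0)" by simp
    show "\<forall>\<^sub>F u in at (0::real). u ^ 4 \<noteq> 0"
      by (rule eventually_mono[OF eventually_neq_at_within[of "0::real" 0 UNIV]]) simp
  qed
  with assms have "(\<lambda>u. B (u ^ 4) - (\<Sum>n<N. d n * (u ^ 4) ^ n)) \<in> O[at 0](\<lambda>u. (u ^ 4) ^ N)"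
    unfolding has_jet_def by (rule landau_o.big.compose)
  moreover have "(\<lambda>u::real. u ^ j) \<in> O[at 0](\<lambda>u. 1)" using power_bigo_power[of 0 j] by simp
  ultimately have "(\<lambda>u. u ^ j * (B (u ^ 4) - (\<Sum>n<N. d n * (u ^ 4) ^ n))) \<in> O[at 0](\<lambda>u. 1 * (u ^ 4) ^ N)"
    by (intro landau_o.big.mult)
  moreover have "u ^ j * (B (u ^ 4) - (\<Sum>n<N. d n * (u ^ 4) ^ n)) =
      u ^ j * B (u ^ 4) - (\<Sum>n<N. d n * u ^ (4 * n + j))" for u
    by (simp add: right_diff_distrib sum_distrib_left power_add power_mult[symmetric] mult_ac)
  ultimately show ?thesis by (simp only: mult_1 power_mult)
qed

text \<open>As 5 is 1 modulo 4, the residue of an exponent decides how many factors u^5 it takes; 0,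
  5, 10, 15 are the smallest members of the four classes. The progressions from 5, 10 and 15
  overshoot degree 4N by the exponents 4N + j of the last sum, and at N = 0 these are exactly the
  gaps.\<close>

lemma semigroup_4_5_sum:
  fixes c :: "nat \<Rightarrow> real"
  assumes "\<And>k. k \<in> {1, 2, 3, 6, 7, 11} \<Longrightarrow> c k = 0"
  shows "(\<Sum>n<N. c (4*n) * u ^ (4*n)) + (\<Sum>n<N. c (4*n+5) * u ^ (4*n+5)) +
      (\<Sum>n<N. c (4*n+10) * u ^ (4*n+10)) + (\<Sum>n<N. c (4*n+15) * u ^ (4*n+15)) =
    (\<Sum>k<4*N. c k * u ^ k) + (\<Sum>j\<in>{1,2,6,3,7,11}. c (4*N+j) * u ^ (4*N+j))"
proof (induction N)
  case 0
  then show ?case using assms by simp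
next
  case (Suc N)
  have "(\<Sum>k<4 * Suc N. c k * u ^ k) = (\<Sum>k<4 * N. c k * u ^ k) + c (4*N) * u ^ (4*N) +
     c (4*N+1) * u ^ (4*N+1) + c (4*N+2) * u ^ (4*N+2) + c (4*N+3) * u ^ (4*N+3)"
    by (simp add: numeral_eq_Suc)
  moreover have "(\<Sum>j\<in>{1,2,6,3,7,11}. c (4 * Suc N+j) * u ^ (4 * Suc N+j)) =
     c (4*N+5) * u ^ (4*N+5) + c (4*N+6) * u ^ (4*N+6) + c (4*N+10) * u ^ (4*N+10)
      + c (4*N+7) * u ^ (4*N+7) + c (4*N+11) * u ^ (4*N+11) + c (4*N+15) * u ^ (4*N+15)"
    by (simp add: algebra_simps del: power_Suc)
  moreover have "(\<Sum>j\<in>{1,2,6,3,7,11}. c (4 * N+j) * u ^ (4 * N+j)) =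
     c (4*N+1) * u ^ (4*N+1) + c (4*N+2) * u ^ (4*N+2) + c (4*N+6) * u ^ (4*N+6)
      + c (4*N+3) * u ^ (4*N+3) + c (4*N+7) * u ^ (4*N+7) + c (4*N+11) * u ^ (4*N+11)"
    by (simp add: algebra_simps del: power_Suc)
  ultimately show ?case using Suc by simp
qed

lemma flat_reflect:
  assumes "flat g"
  shows "flat (\<lambda>u. g (- u))"
  unfolding flat_def
proof
  fix N
  have "g \<in> O[at 0](\<lambda>u. u ^ N)" using assms unfolding flat_def by blast
  moreover have "filterlim (\<lambda>u::real. - u) (at 0) (at 0)"
  proof (rule filterlim_atI)
    have "((\<lambda>u::real. - u) \<longlongrightarrow> - 0) (at 0)" by (intro tendsto_intros)
    then show "((\<lambda>u::real. - u) \<longlongrightarrow> 0) (at 0)" by simp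
    show "\<forall>\<^sub>F u in at (0::real). - u \<noteq> 0"
      by (rule eventually_mono[OF eventually_neq_at_within[of "0::real" 0 UNIV]]) simp
  qed
  ultimately have "(\<lambda>u. g (- u)) \<in> O[at 0](\<lambda>u. (- u) ^ N)" by (rule landau_o.big.compose)
  moreover have "(\<lambda>u::real. (- u) ^ N) \<in> O[at 0](\<lambda>u. u ^ N)"
    by (rule bigoI[of _ 1]) (simp add: power_abs)
  ultimately show "(\<lambda>u. g (- u)) \<in> O[at 0](\<lambda>u. u ^ N)" by (rule landau_o.big_trans)
qed

lemma bigo_cmult:
  fixes f g :: "real \<Rightarrow> real"
  assumes "f \<in> O[F](g)"
  shows "(\<lambda>x. c * f x) \<in> O[F](g)"
proof -
  obtain K where "\<forall>\<^sub>F x in F. norm (f x) \<le> K * norm (g x)" using assms by (auto simp: bigo_def)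
  then have "\<forall>\<^sub>F x in F. norm (c * f x) \<le> (\<bar>c\<bar> * K) * norm (g x)"
    by eventually_elim (simp add: abs_mult mult.assoc mult_left_mono)
  then show ?thesis by (rule bigoI)
qed

lemma flat_lincomb:
  assumes "flat f" "flat g"
  shows "flat (\<lambda>u. a * f u + b * g u)"
  unfolding flat_def
proof
  fix N
  have "f \<in> O[at 0](\<lambda>u. u ^ N)" "g \<in> O[at 0](\<lambda>u. u ^ N)" using assms unfolding flat_def by blast+
  then show "(\<lambda>u. a * f u + b * g u) \<in> O[at 0](\<lambda>u. u ^ N)"
    by (intro sum_in_bigo(1) bigo_cmult)
qed

text \<open>A division statement for smooth functions, with exponents sorted by residue modulo 4.
  The last two conclusions record the first-order data that later form the Jacobian of \<Phi> at the
  origin.\<close>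

lemma smooth_factor_through_4_5:
  fixes f :: "real \<Rightarrow> real"
  assumes r: "r > 0" and f: "smooth_on {-r<..<r} f"
    and gaps: "\<And>k. k \<in> {1, 2, 3, 6, 7, 11} \<Longrightarrow> cderiv k f 0 = 0"
  obtains b0 b1 b2 b3 where
    "smooth_on {-(r^4)<..<r^4} b0" "smooth_on {-(r^4)<..<r^4} b1"
    "smooth_on {-(r^4)<..<r^4} b2" "smooth_on {-(r^4)<..<r^4} b3"
    "\<And>u. u \<in> {-r<..<r} \<Longrightarrow> f u = b0 (u^4) + u^5 * b1 (u^4) + u^10 * b2 (u^4) + u^15 * b3 (u^4)"
    "(b0 has_real_derivative cderiv 4 f 0 / fact 4) (at 0)" "b1 0 = cderiv 5 f 0 / fact 5"
proof -
  let ?S = "{-r<..<r}" and ?T = "{-(r^4)<..<r^4}"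
  define c where "c k = cderiv k f 0 / fact k" for k
  \<comment> \<open>\<open>B j\<close> carries the Taylor coefficients of degrees j, j + 4, j + 8,
    ..., read as a series in u^4.\<close>
  have "\<exists>B. smooth_on UNIV B \<and> (\<forall>k. cderiv k B 0 = fact k * c (4 * k + j))" for j
    by (rule borel_lemma)
  then obtain B where B: "\<And>j. smooth_on UNIV (B j)" and Bc: "\<And>j k. cderiv k (B j) 0 = fact k * c (4 * k + j)"
    by metis
  have BT: "smooth_on ?T (B j)" for j using B smooth_on_subset by blast
  have Bj: "has_jet N (B j) (\<lambda>k. c (4 * k + j))" for N j
    using smooth_on_has_jet[OF _ _ B, of N j] by (simp add: Bc)
  define g where "g u = f u - (u^0 * B 0 (u^4) + u^5 * B 5 (u^4) + u^10 * B 10 (u^4) + u^15 * B 15 (u^4))" for u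
  have u4: "u^4 \<in> ?T" if "u \<in> ?S" for u
  proof -
    have "\<bar>u\<bar> ^ 4 < r ^ 4" using that by (intro power_strict_mono) auto
    then show ?thesis using r by (auto simp: less_le_trans[of _ 0])
  qed
  have comp: "smooth_on ?S (\<lambda>u. B j (u^4))" for j
    by (rule smooth_on_compose[OF _ _ _ BT]) (use u4 in \<open>auto intro!: smooth_on_power smooth_on_ident_real\<close>)
  have g: "smooth_on ?S g"
    unfolding g_def
    by (intro smooth_on_minus smooth_on_add smooth_on_mult comp smooth_on_power smooth_on_ident_real f) auto
  have "g \<in> O[at 0](\<lambda>u. u ^ N)" for N
  proof -
    let ?P = "\<lambda>j u. \<Sum>n<N. c (4 * n + j) * u ^ (4 * n + j)"
    let ?E = "\<lambda>u. \<Sum>j\<in>{1,2,6,3,7,11}. c (4*N+j) * u ^ (4*N+j)"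
    have J: "(\<lambda>u. u ^ j * B j (u ^ 4) - ?P j u) \<in> O[at 0](\<lambda>u. u ^ (4 * N))" for j
      by (rule has_jet_power4_bigo[OF Bj])
    have F: "(\<lambda>u. f u - (\<Sum>k<4*N. c k * u ^ k)) \<in> O[at 0](\<lambda>u. u ^ (4 * N))"
      using smooth_on_has_jet[OF _ _ f, of "4 * N"] r unfolding has_jet_def c_def by simp
    have E: "?E \<in> O[at 0](\<lambda>u. u ^ (4 * N))"
      by (intro big_sum_in_bigo bigo_cmult power_bigo_power) simp
    have "c k = 0" if "k \<in> {1,2,3,6,7,11}" for k using gaps[OF that] by (simp add: c_def)
    then have S: "?P 0 u + ?P 5 u + ?P 10 u + ?P 15 u = (\<Sum>k<4*N. c k * u ^ k) + ?E u" for u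
      unfolding add_0_right by (rule semigroup_4_5_sum)
    have "x + y + z + w = s + t \<Longrightarrow> p - (i + j + k + l) = (p - s) - (i - x) - (j - y) - (k - z) - (l - w) - t"
      for x y z w s t p i j k l :: real by simp
    from this[OF S] have "g u = (f u - (\<Sum>k<4*N. c k * u ^ k)) - (u ^ 0 * B 0 (u ^ 4) - ?P 0 u) - (u ^ 5 * B 5 (u ^ 4) - ?P 5 u)
       - (u ^ 10 * B 10 (u ^ 4) - ?P 10 u) - (u ^ 15 * B 15 (u ^ 4) - ?P 15 u) - ?E u" for u
      unfolding g_def .
    then have "g = (\<lambda>u. (f u - (\<Sum>k<4*N. c k * u ^ k)) - (u ^ 0 * B 0 (u ^ 4) - ?P 0 u) - (u ^ 5 * B 5 (u ^ 4) - ?P 5 u)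
       - (u ^ 10 * B 10 (u ^ 4) - ?P 10 u) - (u ^ 15 * B 15 (u ^ 4) - ?P 15 u) - ?E u)" by (rule ext)
    moreover have "\<dots> \<in> O[at 0](\<lambda>u. u ^ (4 * N))"
      by (intro sum_in_bigo(2) F J E)
    ultimately have "g \<in> O[at 0](\<lambda>u. u ^ (4 * N))" by (simp only:)
    moreover have "(\<lambda>u::real. u ^ (4 * N)) \<in> O[at 0](\<lambda>u. u ^ N)" by (rule power_bigo_power) simp
    ultimately show ?thesis by (rule landau_o.big_trans)
  qed
  then have gflat: "flat g" unfolding flat_def by blast
  have g0: "g 0 = 0" using gflat flat_iff_cderiv[OF _ _ g] r by (metis cderiv_0 greaterThanLessThan_iff neg_less_0_iff_less open_greaterThanLessThan)
  \<comment> \<open>u^4 determines only |u|, so the flat remainder is split by parity. The even part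
    is a function of |u|; the odd part becomes even after division by u^5.\<close>
  define e where "e u = (1/2) * g u + (1/2) * g (- u)" for u
  define d where "d u = (1/2) * g u + (-1/2) * g (- u)" for u
  have "smooth_on ?S (\<lambda>u. 0 - u)" by (intro smooth_on_minus smooth_on_const smooth_on_ident_real) auto
  then have "smooth_on ?S (\<lambda>u. - u)" by simp
  then have gm: "smooth_on ?S (\<lambda>u. g (- u))"
    by (intro smooth_on_compose[OF _ _ _ g]) auto
  have ed: "smooth_on ?S e" "smooth_on ?S d"
    unfolding e_def d_def by (intro smooth_on_add smooth_on_mult smooth_on_const g gm; simp)+
  have edflat: "flat e" "flat d"
    unfolding e_def d_def by (intro flat_lincomb gflat flat_reflect)+
  \<comment> \<open>Both corrections come from flat functions, so at 0 they change neither the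
    derivative of \<open>?b0\<close> nor the value of \<open>?b1\<close>.\<close>
  let ?b0 = "\<lambda>s. B 0 s + root4 e 0 s" and ?b1 = "\<lambda>s. B 5 s + root4 d 5 s"
  show thesis
  proof
    show "smooth_on ?T ?b0" "smooth_on ?T ?b1" "smooth_on ?T (B 10)" "smooth_on ?T (B 15)"
      by (intro smooth_on_add BT smooth_on_root4 r ed edflat; simp)+
    fix u assume u: "u \<in> ?S"
    have "root4 e 0 (u^4) + u^5 * root4 d 5 (u^4) = g u"
    proof (cases "u = 0")
      case False
      have [simp]: "root 4 (u ^ 4) = \<bar>u\<bar>" using real_root_power_cancel[of 4 "\<bar>u\<bar>"] by simp
      have "root4 e 0 (u^4) = e u" using False by (auto simp: root4_def e_def abs_if)
      moreover have "u^5 * root4 d 5 (u^4) = d u" using False by (auto simp: root4_def d_def abs_if field_simps)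
      ultimately show ?thesis by (simp add: e_def d_def)
    qed (simp add: root4_def g0)
    then show "f u = ?b0 (u^4) + u^5 * ?b1 (u^4) + u^10 * B 10 (u^4) + u^15 * B 15 (u^4)"
      unfolding g_def by (simp add: algebra_simps)
  next
    have "(B 0 has_real_derivative c 4) (at 0)"
      using smooth_on_cderiv_DERIV[OF B, of 0 0 0] Bc[of "Suc 0" 0] by simp
    moreover have "(root4 e 0 has_real_derivative 0) (at 0)"
      using root4_DERIV[OF r ed(1) edflat(1), of 0 0] r by (simp add: root4_def)
    ultimately show "(?b0 has_real_derivative cderiv 4 f 0 / fact 4) (at 0)"
      using DERIV_add by (fastforce simp: c_def)
    show "?b1 0 = cderiv 5 f 0 / fact 5" using Bc[of 0 5] by (simp add: root4_def c_def)
  qed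
qed

section \<open>Inverse functions\<close>

text \<open>The vectors \<open>M v x\<close> are the columns of the inverse Jacobian, required to
  depend smoothly on x. The inverse function theorem yields a differentiable local inverse whose
  partial derivatives are \<open>M v (g y)\<close>, and the bootstrap makes it smooth.\<close>

lemma smooth_inverse_function:
  fixes f :: "'a::euclidean_space \<Rightarrow> 'a"
  assumes "open U" "x0 \<in> U" and f: "smooth_on U f"
    and M: "\<And>v. v \<in> Basis \<Longrightarrow> smooth_on U (M v)"
    and MD: "\<And>v x. v \<in> Basis \<Longrightarrow> x \<in> U \<Longrightarrow> (\<Sum>b\<in>Basis. (M v x \<bullet> b) *\<^sub>R pd b f x) = v"
  obtains g where "diffeo_germ g f (f x0) x0"
proof -
  define f' where "f' x = Blinfun (\<lambda>h. \<Sum>v\<in>Basis. (h \<bullet> v) *\<^sub>R pd v f x)" for x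
  have "bounded_linear (\<lambda>h. \<Sum>v\<in>Basis. (h \<bullet> v) *\<^sub>R pd v f x)" for x
    by (intro bounded_linear_sum bounded_linear_scaleR_left[THEN bounded_linear_compose] bounded_linear_inner_left)
  then have f'_apply: "blinfun_apply (f' x) = (\<lambda>h. \<Sum>v\<in>Basis. (h \<bullet> v) *\<^sub>R pd v f x)" for x
    unfolding f'_def by (rule bounded_linear_Blinfun_apply)
  have f'_basis: "blinfun_apply (f' x) v = pd v f x" if "v \<in> Basis" for x v
    using that by (simp add: f'_apply inner_Basis if_distrib[of "\<lambda>t. t *\<^sub>R _"] cong: if_cong)
  have der: "(f has_derivative blinfun_apply (f' x)) (at x)" if "x \<in> U" for x
    unfolding f'_apply by (rule smooth_on_has_derivative[OF assms(1) that f])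
  have cont: "continuous_on U f'"
    by (rule continuous_on_blinfun_componentwise)
      (simp add: f'_basis smooth_on_continuous[OF smooth_on_pd[OF f]])
  define L where "L = Blinfun (\<lambda>h. \<Sum>v\<in>Basis. (h \<bullet> v) *\<^sub>R M v x0)"
  have "bounded_linear (\<lambda>h. \<Sum>v\<in>Basis. (h \<bullet> v) *\<^sub>R M v x0)"
    by (intro bounded_linear_sum bounded_linear_scaleR_left[THEN bounded_linear_compose] bounded_linear_inner_left)
  then have L_apply: "blinfun_apply L = (\<lambda>h. \<Sum>v\<in>Basis. (h \<bullet> v) *\<^sub>R M v x0)"
    unfolding L_def by (rule bounded_linear_Blinfun_apply)
  have f'M: "blinfun_apply (f' x) (M v x) = v" if "v \<in> Basis" "x \<in> U" for v x
    using MD[OF that] by (simp add: f'_apply)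
  have "blinfun_apply (f' x0) (blinfun_apply L h) = h" for h
    unfolding L_apply using f'M assms(2)
    by (simp add: blinfun.sum_right blinfun.scaleR_right euclidean_representation)
  then have "blinfun_apply (f' x0) \<circ> blinfun_apply L = id" by (simp add: fun_eq_iff)
  \<comment> \<open>\<open>L\<close> is a right inverse of the derivative; in finite dimension it is
    also the left inverse that the inverse function theorem expects.\<close>
  then have "blinfun_apply L \<circ> blinfun_apply (f' x0) = id"
    by (subst linear_inverse_left) (auto intro: bounded_linear.linear blinfun.bounded_linear_right)
  then have "L o\<^sub>L f' x0 = id_blinfun"
    by (intro blinfun_eqI) (simp add: fun_eq_iff)
  from inverse_function_theorem[OF assms(1) der cont assms(2) this]
  obtain U' V g g' where UV: "open U'" "U' \<subseteq> U" "x0 \<in> U'" "open V" "f x0 \<in> V"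
    and hom: "homeomorphism U' V f g"
    and g': "\<And>y. y \<in> V \<Longrightarrow> (g has_derivative (g' y)) (at y)"
      "\<And>y. y \<in> V \<Longrightarrow> g' y = inv (blinfun_apply (f' (g y)))"
      "\<And>y. y \<in> V \<Longrightarrow> bij (blinfun_apply (f' (g y)))"
    by metis
  have gU: "g ` V \<subseteq> U" using hom UV(2) by (auto simp: homeomorphism_def)
  have part: "has_partial v g (M v (g y)) y" if v: "v \<in> Basis" and y: "y \<in> V" for v y
  proof -
    have "g y \<in> U" using gU y by auto
    then have "g' y v = M v (g y)"
      unfolding g'(2)[OF y] by (metis bij_inv_eq_iff f'M[OF v] g'(3)[OF y])
    moreover have "((\<lambda>t. g (y + t *\<^sub>R v)) has_derivative (\<lambda>t. g' y (t *\<^sub>R v))) (at 0)"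
      by (rule has_derivative_compose[of "\<lambda>t. y + t *\<^sub>R v" "\<lambda>t. t *\<^sub>R v"])
        (auto intro!: derivative_eq_intros simp: g'(1)[OF y])
    moreover have "g' y (t *\<^sub>R v) = t *\<^sub>R g' y v" for t
      using has_derivative_linear[OF g'(1)[OF y]] by (simp add: linear_cmul)
    ultimately show ?thesis unfolding has_partial_def has_vector_derivative_def by simp
  qed
  have "smooth_on V g"
    by (rule smooth_on_if_partials_factor[OF assms(1) UV(4) gU _ M part])
      (use hom in \<open>auto simp: homeomorphism_def\<close>)
  moreover have "smooth_on U' f" using f UV(2) smooth_on_subset by blast
  ultimately have "diffeo_germ g f (f x0) x0"
    unfolding diffeo_germ_def using UV hom by (auto simp: homeomorphism_def)
  then show thesis by (rule that)
qed

lemma smooth_inverse_function_real: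
  fixes f :: "real \<Rightarrow> real"
  assumes "open U" "x0 \<in> U" "smooth_on U f" "cderiv 1 f x0 \<noteq> 0"
  obtains g where "diffeo_germ g f (f x0) x0"
proof -
  let ?d = "pd 1 f"
  have d: "smooth_on U ?d" using assms(3) by (simp add: smooth_on_pd)
  define W where "W = U \<inter> ?d -` (- {0})"
  have "open W" unfolding W_def
    by (rule continuous_open_preimage[OF smooth_on_continuous[OF d] assms(1)]) auto
  moreover have "x0 \<in> W" using assms(2,4) by (simp add: W_def cderiv_Suc)
  moreover have W: "W \<subseteq> U" by (auto simp: W_def)
  moreover have "smooth_on W (\<lambda>x. inverse (?d x))"
    by (rule smooth_on_inverse[OF \<open>open W\<close> smooth_on_subset[OF d W]]) (auto simp: W_def)
  ultimately show thesis
    using smooth_inverse_function[of W x0 f "\<lambda>v x. inverse (?d x)"] that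
    by (auto simp: smooth_on_subset[OF assms(3)] W_def)
qed

section \<open>Coordinates, determinants and local inversion in the plane\<close>

lemma Basis_real2: "(Basis :: (real^2) set) = {axis 1 1, axis 2 1}"
  by (auto simp: Basis_vec_def UNIV_2)

lemma sum_Basis_real2: "(\<Sum>b\<in>(Basis :: (real^2) set). h b) = h (axis 1 1) + h (axis 2 1)"
  unfolding Basis_real2 by (subst sum.insert) (auto simp: axis_eq_axis)

lemma det2_eq: "det2 u v = u$1 * v$2 - u$2 * v$1"
  by (simp add: det2_def det_2 transpose_def vector_2)

lemma smooth_on_vec_nth:
  fixes f :: "'a::euclidean_space \<Rightarrow> real^'n"
  assumes "open S"
  shows "smooth_on S f \<longleftrightarrow> (\<forall>i. smooth_on S (\<lambda>x. f x $ i))"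
  unfolding smooth_on_componentwise[OF assms, of f]
  by (auto simp: Basis_vec_def inner_axis)

lemma has_partial_vec_nth:
  fixes f :: "'a::euclidean_space \<Rightarrow> real^'n"
  shows "has_partial v f d x \<Longrightarrow> has_partial v (\<lambda>x. f x $ i) (d $ i) x"
  using has_partial_inner[of v f d x "axis i 1"] by (simp add: inner_axis)

lemma pd_vec_nth:
  fixes f :: "'a::euclidean_space \<Rightarrow> real^'n"
  assumes "smooth_on S f" "v \<in> Basis" "x \<in> S"
  shows "pd v (\<lambda>x. f x $ i) x = pd v f x $ i"
  by (intro has_partial_imp_pd has_partial_vec_nth smooth_on_partial[OF assms])

lemma cderiv_vec_nth:
  fixes f :: "real \<Rightarrow> real^'n"
  assumes "open S" "smooth_on S f" "x \<in> S"
  shows "cderiv k (\<lambda>x. f x $ i) x = cderiv k f x $ i"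
  using assms(3)
proof (induction k arbitrary: x)
  case (Suc k)
  have "has_partial 1 (\<lambda>x. cderiv k f x $ i) (cderiv (Suc k) f x $ i) x"
    unfolding cderiv_Suc by (intro has_partial_vec_nth smooth_on_partial[OF smooth_on_cderiv[OF assms(2)]] Suc.prems) simp
  then have "has_partial 1 (cderiv k (\<lambda>x. f x $ i)) (cderiv (Suc k) f x $ i) x"
    using has_partial_cong[OF assms(1) Suc.prems, of "cderiv k (\<lambda>x. f x $ i)" "\<lambda>x. cderiv k f x $ i"] Suc.IH by blast
  then show ?case by (simp add: cderiv_Suc has_partial_imp_pd)
qed simp

lemma smooth_inverse_function_real2:
  fixes f :: "real^2 \<Rightarrow> real^2"
  assumes U: "open U" "x0 \<in> U" "smooth_on U f"
    and "det2 (pd (axis 1 1) f x0) (pd (axis 2 1) f x0) \<noteq> 0"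
  obtains g where "diffeo_germ g f (f x0) x0"
proof -
  let ?p = "pd (axis 1 1) f" and ?q = "pd (axis 2 1) f"
  define J where "J x = ?p x $ 1 * ?q x $ 2 - ?p x $ 2 * ?q x $ 1" for x
  have pq: "smooth_on U ?p" "smooth_on U ?q" using U(3) by (auto intro!: smooth_on_pd simp: Basis_real2)
  then have pqi: "smooth_on U (\<lambda>x. ?p x $ i)" "smooth_on U (\<lambda>x. ?q x $ i)" for i
    using smooth_on_vec_nth[OF U(1)] by blast+
  have J: "smooth_on U J" unfolding J_def by (intro smooth_on_minus smooth_on_mult pqi U(1))
  define W where "W = U \<inter> J -` (- {0})"
  have oW: "open W" unfolding W_def
    by (rule continuous_open_preimage[OF smooth_on_continuous[OF J] U(1)]) auto
  have x0: "x0 \<in> W" using assms(2,4) by (simp add: W_def J_def det2_eq)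
  have W: "W \<subseteq> U" by (auto simp: W_def)
  have J0: "J x \<noteq> 0" if "x \<in> W" for x using that by (simp add: W_def)
  \<comment> \<open>Cramer's rule: the coordinates of \<open>v\<close> with respect to the columns
    \<open>?p x\<close> and \<open>?q x\<close> of the Jacobian.\<close>
  define M :: "real^2 \<Rightarrow> real^2 \<Rightarrow> real^2" where
    "M v x = vector [(v$1 * ?q x $ 2 - v$2 * ?q x $ 1) * inverse (J x), (v$2 * ?p x $ 1 - v$1 * ?p x $ 2) * inverse (J x)]" for v x
  have "smooth_on W (M v)" for v
    unfolding smooth_on_vec_nth[OF oW, of "M v"] M_def forall_2 vector_2
    by (intro conjI smooth_on_minus smooth_on_mult smooth_on_const smooth_on_inverse
        smooth_on_subset[OF J W] smooth_on_subset[OF pqi(1) W] smooth_on_subset[OF pqi(2) W] oW J0)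
  moreover have "(\<Sum>b\<in>Basis. (M v x \<bullet> b) *\<^sub>R pd b f x) = v" if "x \<in> W" for v x
  proof -
    have "M v x $ 1 * ?p x $ i + M v x $ 2 * ?q x $ i = v $ i" for i
    proof -
      have "M v x $ 1 * ?p x $ i + M v x $ 2 * ?q x $ i =
        ((v$1 * ?q x $ 2 - v$2 * ?q x $ 1) * ?p x $ i + (v$2 * ?p x $ 1 - v$1 * ?p x $ 2) * ?q x $ i) * inverse (J x)"
        by (simp add: M_def algebra_simps)
      also have "(v$1 * ?q x $ 2 - v$2 * ?q x $ 1) * ?p x $ i + (v$2 * ?p x $ 1 - v$1 * ?p x $ 2) * ?q x $ i = v $ i * J x"
        using exhaust_2[of i] by (auto simp: J_def algebra_simps)
      finally show ?thesis using J0[OF that] by simp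
    qed
    then show ?thesis by (simp add: sum_Basis_real2 vec_eq_iff inner_axis)
  qed
  ultimately show thesis
    using smooth_inverse_function[OF oW x0 smooth_on_subset[OF U(3) W], of M] that by blast
qed

text \<open>Differentiating g (f x) = x at a shows that the derivative of g at b is a left inverse
  of that of f at a.\<close>

lemma diffeo_germ_derivative_injective:
  fixes f :: "'a::euclidean_space \<Rightarrow> 'a"
  assumes "diffeo_germ f g a b" "(\<Sum>v\<in>Basis. (h \<bullet> v) *\<^sub>R pd v f a) = 0"
  shows "h = 0"
proof -
  obtain U V where U: "open U" "a \<in> U" "smooth_on U f" "\<And>x. x \<in> U \<Longrightarrow> g (f x) = x"
    and V: "open V" "b \<in> V" "smooth_on V g" and fa: "f a = b"
    using assms(1) unfolding diffeo_germ_def by blast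
  let ?F = "\<lambda>h. \<Sum>v\<in>Basis. (h \<bullet> v) *\<^sub>R pd v f a" and ?G = "\<lambda>h. \<Sum>v\<in>Basis. (h \<bullet> v) *\<^sub>R pd v g b"
  have "((\<lambda>x. g (f x)) has_derivative (\<lambda>h. ?G (?F h))) (at a)"
    using has_derivative_compose[OF smooth_on_has_derivative[OF U(1-3)]] smooth_on_has_derivative[OF V] fa by simp
  moreover have "\<forall>\<^sub>F x in nhds a. x = g (f x)"
    using eventually_nhds_in_open[OF U(1,2)] by eventually_elim (simp add: U(4))
  then have "((\<lambda>x. g (f x)) has_derivative (\<lambda>h. h)) (at a)"
    using has_derivative_transform_eventually[OF has_derivative_ident, of "\<lambda>x. g (f x)" a UNIV] U(2,4)
    by (simp add: eventually_at_filter eventually_mono)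
  ultimately have "(\<lambda>h. ?G (?F h)) = (\<lambda>h. h)" by (rule has_derivative_unique)
  then have "?G (?F h) = h" by (rule fun_cong)
  then show ?thesis using assms(2) by simp
qed

text \<open>The partial derivatives are differentiable at 0, so they vary there by at most a
  multiple of the norm; the mean value theorem on the segment from 0 to p supplies the other factor.
  Along the cusp, where p has size u^4, the error is of order 8.\<close>

lemma smooth_first_order_bound:
  fixes F :: "'a::euclidean_space \<Rightarrow> real"
  assumes V: "open V" "0 \<in> V" and F: "smooth_on V F"
  obtains K where "\<forall>\<^sub>F p in nhds 0. \<bar>F p - F 0 - (\<Sum>b\<in>Basis. (p \<bullet> b) * pd b F 0)\<bar> \<le> K * (norm p)\<^sup>2"
proof -
  have "\<exists>d K. d > 0 \<and> (\<forall>p. norm p < d \<longrightarrow> \<bar>pd b F p - pd b F 0\<bar> \<le> K * norm p)" if "b \<in> Basis" for b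
  proof -
    have "(pd b F has_derivative (\<lambda>h. \<Sum>v\<in>Basis. (h \<bullet> v) *\<^sub>R pd v (pd b F) 0)) (at 0)"
      by (rule smooth_on_has_derivative[OF V smooth_on_pd[OF F that]])
    then obtain L where L: "(pd b F has_derivative L) (at 0)" by blast
    then obtain d where d: "d > 0" "\<And>p. norm (p - 0) < d \<Longrightarrow> norm (pd b F p - pd b F 0 - L (p - 0)) \<le> 1 * norm (p - 0)"
      unfolding has_derivative_at_alt using zero_less_one by blast
    obtain K where K: "\<And>h. norm (L h) \<le> norm h * K"
      using bounded_linear.bounded[OF has_derivative_bounded_linear[OF L]] by blast
    have "\<bar>pd b F p - pd b F 0\<bar> \<le> (1 + K) * norm p" if "norm p < d" for p
      using d(2)[of p] K[of p] that by (simp add: algebra_simps)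
    with d(1) show ?thesis by blast
  qed
  then obtain d K where d: "\<And>b. b \<in> Basis \<Longrightarrow> d b > 0"
    and K: "\<And>b p. b \<in> Basis \<Longrightarrow> norm p < d b \<Longrightarrow> \<bar>pd b F p - pd b F 0\<bar> \<le> K b * norm p"
    by metis
  obtain e where e: "e > 0" "ball 0 e \<subseteq> V" using V open_contains_ball by blast
  define r where "r = Min (insert e (d ` Basis))"
  have r: "r > 0" "r \<le> e" using d e(1) by (auto simp: r_def)
  have rd: "r \<le> d b" if "b \<in> Basis" for b unfolding r_def by (rule Min_le) (use that in auto)
  have "\<bar>F p - F 0 - (\<Sum>b\<in>Basis. (p \<bullet> b) * pd b F 0)\<bar> \<le> (\<Sum>b\<in>Basis. \<bar>K b\<bar>) * (norm p)\<^sup>2" if p: "norm p < r" for p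
  proof -
    have small: "norm (s *\<^sub>R p) \<le> norm p" if "\<bar>s\<bar> \<le> 1" for s
      using that by (simp add: mult_left_le_one_le)
    have inV: "s *\<^sub>R p \<in> V" if "\<bar>s\<bar> \<le> 1" for s
      using small[OF that] p r(2) e(2) by auto
    have der: "((\<lambda>s. F (s *\<^sub>R p)) has_real_derivative (\<Sum>b\<in>Basis. (p \<bullet> b) * pd b F (s *\<^sub>R p))) (at s)" if "\<bar>s\<bar> \<le> 1" for s
    proof -
      have "((\<lambda>s. F (s *\<^sub>R p)) has_derivative (\<lambda>t. \<Sum>b\<in>Basis. ((t *\<^sub>R p) \<bullet> b) *\<^sub>R pd b F (s *\<^sub>R p))) (at s)"
        by (rule has_derivative_compose[where f = "\<lambda>s. s *\<^sub>R p"])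
          (rule bounded_linear_imp_has_derivative[OF bounded_linear_scaleR_left],
           rule smooth_on_has_derivative[OF V(1) inV[OF that] F])
      then show ?thesis
        by (rule has_derivative_imp_has_field_derivative) (simp add: sum_distrib_left mult_ac)
    qed
    have "\<exists>z::real. 0 < z \<and> z < 1 \<and> F (1 *\<^sub>R p) - F (0 *\<^sub>R p) = (1 - 0) * (\<Sum>b\<in>Basis. (p \<bullet> b) * pd b F (z *\<^sub>R p))"
      by (rule MVT2) (auto intro: der)
    then obtain z :: real where z: "0 < z" "z < 1" "F p - F 0 = (\<Sum>b\<in>Basis. (p \<bullet> b) * pd b F (z *\<^sub>R p))" by auto
    have zp: "norm (z *\<^sub>R p) \<le> norm p" by (rule small) (use z in simp)
    have "\<bar>F p - F 0 - (\<Sum>b\<in>Basis. (p \<bullet> b) * pd b F 0)\<bar> = \<bar>\<Sum>b\<in>Basis. (p \<bullet> b) * (pd b F (z *\<^sub>R p) - pd b F 0)\<bar>"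
      by (simp add: z(3) right_diff_distrib sum_subtractf)
    also have "\<dots> \<le> (\<Sum>b\<in>Basis. \<bar>(p \<bullet> b) * (pd b F (z *\<^sub>R p) - pd b F 0)\<bar>)" by (rule sum_abs)
    also have "\<dots> \<le> (\<Sum>b\<in>Basis. \<bar>K b\<bar> * (norm p)\<^sup>2)"
    proof (rule sum_mono)
      fix b :: 'a assume b: "b \<in> Basis"
      have "\<bar>pd b F (z *\<^sub>R p) - pd b F 0\<bar> \<le> K b * norm (z *\<^sub>R p)"
        by (rule K[OF b]) (use zp p rd[OF b] in linarith)
      also have "\<dots> \<le> \<bar>K b\<bar> * norm p" using zp by (intro mult_mono) auto
      finally have "\<bar>p \<bullet> b\<bar> * \<bar>pd b F (z *\<^sub>R p) - pd b F 0\<bar> \<le> norm p * (\<bar>K b\<bar> * norm p)"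
        using Basis_le_norm[OF b] by (intro mult_mono) auto
      then show "\<bar>(p \<bullet> b) * (pd b F (z *\<^sub>R p) - pd b F 0)\<bar> \<le> \<bar>K b\<bar> * (norm p)\<^sup>2"
        by (simp add: abs_mult power2_eq_square mult_ac)
    qed
    finally show ?thesis by (simp add: sum_distrib_right)
  qed
  then have "\<forall>\<^sub>F p in nhds 0. \<bar>F p - F 0 - (\<Sum>b\<in>Basis. (p \<bullet> b) * pd b F 0)\<bar> \<le> (\<Sum>b\<in>Basis. \<bar>K b\<bar>) * (norm p)\<^sup>2"
    unfolding eventually_nhds_metric using r(1) by (intro exI[of _ r]) auto
  then show thesis by (rule that)
qed

section \<open>Jets of compositions\<close>

text \<open>Disposes of explicitly computed remainders: only continuity of the cofactor at 0 has to
  be checked.\<close>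

lemma power_mult_bigo:
  fixes R :: "real \<Rightarrow> real"
  assumes "isCont R 0"
  shows "(\<lambda>u. u ^ N * R u) \<in> O[at 0](\<lambda>u. u ^ N)"
proof -
  have "R \<in> O[at 0](\<lambda>u. 1)"
    by (rule bigoI_tendsto[of _ _ "R 0"]) (use assms in \<open>simp_all add: isCont_def\<close>)
  from landau_o.big.mult[OF landau_o.big_refl this, of "\<lambda>u. u ^ N"] show ?thesis by (simp only: mult_1_right)
qed

text \<open>When f - g is split off from f^(k+1) - g^(k+1), each term of the cofactor is a product
  of k functions of order u. Raising to the power k + 1 thus gains k orders of precision.\<close>

lemma power_diff_bigo:
  fixes f g :: "real \<Rightarrow> real"
  assumes fg: "(\<lambda>u. f u - g u) \<in> O[at 0](\<lambda>u. u ^ m)"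
    and f: "f \<in> O[at 0](\<lambda>u. u)" and g: "g \<in> O[at 0](\<lambda>u. u)"
  shows "(\<lambda>u. f u ^ Suc k - g u ^ Suc k) \<in> O[at 0](\<lambda>u. u ^ (m + k))"
proof (induction k)
  case (Suc k)
  have "(\<lambda>u. f u * (f u ^ Suc k - g u ^ Suc k)) \<in> O[at 0](\<lambda>u. u * u ^ (m + k))"
    by (rule landau_o.big.mult[OF f Suc])
  moreover have "(\<lambda>u. (f u - g u) * g u ^ Suc k) \<in> O[at 0](\<lambda>u. u ^ m * u ^ Suc k)"
    by (rule landau_o.big.mult[OF fg landau_o.big_power[OF g]])
  moreover have "u * u ^ (m + k) = u ^ (m + Suc k)" "u ^ m * u ^ Suc k = u ^ (m + Suc k)" for u :: real
    by (simp_all add: power_add)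
  ultimately have "(\<lambda>u. f u * (f u ^ Suc k - g u ^ Suc k) + (f u - g u) * g u ^ Suc k) \<in> O[at 0](\<lambda>u. u ^ (m + Suc k))"
    by (simp only: sum_in_bigo(1))
  moreover have "f u * (f u ^ Suc k - g u ^ Suc k) + (f u - g u) * g u ^ Suc k = f u ^ Suc (Suc k) - g u ^ Suc (Suc k)" for u
    by (simp add: algebra_simps)
  ultimately show ?case by (simp only:)
qed (use fg in simp)

lemma has_jet_mono:
  assumes "has_jet N f c" "n \<le> N"
  shows "has_jet n f c"
  using assms
proof (induction N)
  case (Suc N)
  show ?case
  proof (cases "n = Suc N")
    case False
    have "(\<lambda>u. f u - (\<Sum>k<Suc N. c k * u ^ k)) \<in> O[at 0](\<lambda>u. u ^ N)"
      using Suc.prems(1) unfolding has_jet_def by (rule landau_o.big_trans) (rule power_bigo_power, simp)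
    moreover have "(\<lambda>u. c N * u ^ N) \<in> O[at 0](\<lambda>u. u ^ N)" by (rule bigo_cmult) simp
    ultimately have "(\<lambda>u. (f u - (\<Sum>k<Suc N. c k * u ^ k)) + c N * u ^ N) \<in> O[at 0](\<lambda>u. u ^ N)"
      by (rule sum_in_bigo(1))
    then have "has_jet N f c" by (simp add: has_jet_def)
    with Suc.IH Suc.prems(2) False show ?thesis by simp
  qed (use Suc.prems in simp)
qed simp

text \<open>A nonzero linear coefficient keeps \<open>f u\<close> away from 0 for small u \<noteq>
  0, as is required for substituting \<open>f\<close> into an estimate on a punctured
  neighbourhood.\<close>

lemma has_jet_filterlim_at_0:
  assumes "has_jet 2 f s" "s 0 = 0" "s 1 \<noteq> 0"
  shows "filterlim f (at 0) (at 0)"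
proof -
  have "(\<lambda>u. f u - s 1 * u) \<in> O[at 0](\<lambda>u. u ^ 2)"
    using assms(1,2) by (simp add: has_jet_def eval_nat_numeral)
  then have "(\<lambda>u. (f u - s 1 * u) / u) \<in> O[at 0](\<lambda>u. u ^ 2 / u)"
    by (rule landau_o.big.divide_right[rotated]) (rule eventually_neq_at_within)
  moreover have "((\<lambda>u::real. u ^ 2 / u) \<longlongrightarrow> 0) (at 0)"
    by (rule Lim_transform_eventually[OF tendsto_ident_at]) (simp add: eventually_at_filter power2_eq_square)
  ultimately have "((\<lambda>u. (f u - s 1 * u) / u) \<longlongrightarrow> 0) (at 0)" by (rule bigo_imp_tendsto_0)
  then have "((\<lambda>u. (f u - s 1 * u) / u + s 1) \<longlongrightarrow> 0 + s 1) (at 0)" by (intro tendsto_intros)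
  then have lim: "((\<lambda>u. f u / u) \<longlongrightarrow> s 1) (at 0)"
    by (simp, elim Lim_transform_eventually) (auto simp: eventually_at_filter field_simps)
  then have "((\<lambda>u. f u / u * u) \<longlongrightarrow> s 1 * 0) (at 0)" by (intro tendsto_intros)
  then have "(f \<longlongrightarrow> 0) (at 0)"
    by (simp, elim Lim_transform_eventually) (auto simp: eventually_at_filter)
  moreover have "\<forall>\<^sub>F u in at 0. f u / u \<noteq> 0" using lim assms(3) by (rule tendsto_imp_eventually_ne)
  then have "\<forall>\<^sub>F u in at 0. f u \<noteq> 0" by eventually_elim auto
  ultimately show ?thesis by (rule filterlim_atI)
qed

lemma sum_lessThan_8: "(\<Sum>k<8. h k) = h 0 + h 1 + h 2 + h 3 + h 4 + h 5 + h 6 + h (7::nat)"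
  by (simp add: eval_nat_numeral)

lemma sum_lessThan_12: "(\<Sum>k<12. h k) = h 0 + h 1 + h 2 + h 3 + h 4 + h 5 + h 6 + h 7 + h 8 + h 9 + h 10 + h (11::nat)"
  by (simp add: eval_nat_numeral)

text \<open>The lowest nonconstant power of p that occurs is the fourth. Modulo u^8 the powers p^4,
  p^5, p^6, p^7 need p only modulo u^5, u^4, u^3, u^2, which is why a jet of length 5 suffices for
  the inner function.\<close>

lemma has_jet_compose_order4:
  assumes f: "has_jet 8 f c" "c 1 = 0" "c 2 = 0" "c 3 = 0"
    and p: "has_jet 5 p s" "s 0 = 0" "s 1 \<noteq> 0"
  shows "has_jet 8 (\<lambda>u. f (p u)) ((!) [c 0, 0, 0, 0, c 4 * s 1 ^ 4, c 4 * (4 * s 1 ^ 3 * s 2) + c 5 * s 1 ^ 5,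
     c 4 * (4 * s 1 ^ 3 * s 3 + 6 * s 1 ^ 2 * s 2 ^ 2) + c 5 * (5 * s 1 ^ 4 * s 2) + c 6 * s 1 ^ 6,
     c 4 * (4 * s 1 ^ 3 * s 4 + 12 * s 1 ^ 2 * s 2 * s 3 + 4 * s 1 * s 2 ^ 3) +
       c 5 * (5 * s 1 ^ 4 * s 3 + 10 * s 1 ^ 3 * s 2 ^ 2) + c 6 * (6 * s 1 ^ 5 * s 2) + c 7 * s 1 ^ 7])"
    (is "has_jet 8 _ ((!) ?d)")
proof -
  have p2: "has_jet 2 p s" by (rule has_jet_mono[OF p(1)]) simp
  have p_lim: "filterlim p (at 0) (at 0)" by (rule has_jet_filterlim_at_0[OF p2 p(2,3)])
  have T: "(\<lambda>u. \<Sum>k<n. s k * u ^ k) \<in> O[at 0](\<lambda>u. u)" for n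
  proof (rule big_sum_in_bigo)
    fix k
    show "(\<lambda>u. s k * u ^ k) \<in> O[at 0](\<lambda>u. u)"
      using p(2) power_bigo_power[of 1 k] by (cases "k = 0") (auto intro!: bigo_cmult)
  qed
  have "has_jet 1 p s" by (rule has_jet_mono[OF p(1)]) simp
  then have pO: "p \<in> O[at 0](\<lambda>u. u)" using p(2) by (simp add: has_jet_def)
  have D: "(\<lambda>u. p u ^ Suc k - (\<Sum>k<n. s k * u ^ k) ^ Suc k) \<in> O[at 0](\<lambda>u. u ^ 8)" if "n + k = 8" "n \<le> 5" for k n
  proof -
    have "has_jet n p s" by (rule has_jet_mono[OF p(1) that(2)])
    from power_diff_bigo[OF this[unfolded has_jet_def] pO T, of k] show ?thesis unfolding that(1) .
  qed
  define T4 where "T4 u = s 1 * u + s 2 * u^2 + s 3 * u^3 + s 4 * u^4" for u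
  define T3 where "T3 u = s 1 * u + s 2 * u^2 + s 3 * u^3" for u
  define T2 where "T2 u = s 1 * u + s 2 * u^2" for u
  have D4: "(\<lambda>u. p u ^ 4 - T4 u ^ 4) \<in> O[at 0](\<lambda>u. u ^ 8)"
    using D[of 5 3] p(2) by (simp add: T4_def eval_nat_numeral)
  have D3: "(\<lambda>u. p u ^ 5 - T3 u ^ 5) \<in> O[at 0](\<lambda>u. u ^ 8)"
    using D[of 4 4] p(2) by (simp add: T3_def eval_nat_numeral)
  have D2: "(\<lambda>u. p u ^ 6 - T2 u ^ 6) \<in> O[at 0](\<lambda>u. u ^ 8)"
    using D[of 3 5] p(2) by (simp add: T2_def eval_nat_numeral)
  have D1: "(\<lambda>u. p u ^ 7 - (s 1 * u) ^ 7) \<in> O[at 0](\<lambda>u. u ^ 8)"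
    using D[of 2 6] p(2) by (simp add: eval_nat_numeral)
  \<comment> \<open>The cofactor of u^8 in the expansion of the truncated powers;
    \<open>poly\<close> certifies it as a polynomial identity.\<close>
  define R where "R u =
     c 4 * (6 * s 1 ^ 2 * (2 * s 2 * s 4 + s 3 ^ 2 + 2 * s 3 * s 4 * u + s 4 ^ 2 * u ^ 2) +
       4 * s 1 * (s 3 + s 4 * u) * ((s 2 + s 3 * u + s 4 * u^2) ^ 2 + (s 2 + s 3 * u + s 4 * u^2) * s 2 + s 2 ^ 2) +
       (s 2 + s 3 * u + s 4 * u^2) ^ 4) +
     c 5 * (10 * s 1 ^ 3 * (2 * s 2 * s 3 + s 3 ^ 2 * u) + 10 * s 1 ^ 2 * (s 2 + s 3 * u) ^ 3 +
       5 * s 1 * u * (s 2 + s 3 * u) ^ 4 + u ^ 2 * (s 2 + s 3 * u) ^ 5) +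
     c 6 * (15 * s 1 ^ 4 * s 2 ^ 2 + 20 * s 1 ^ 3 * s 2 ^ 3 * u + 15 * s 1 ^ 2 * s 2 ^ 4 * u ^ 2 +
       6 * s 1 * s 2 ^ 5 * u ^ 3 + s 2 ^ 6 * u ^ 4)" for u
  have R: "(\<lambda>u. u ^ 8 * R u) \<in> O[at 0](\<lambda>u. u ^ 8)"
    by (rule power_mult_bigo) (unfold R_def, intro continuous_intros)
  have main: "(\<lambda>u. f (p u) - (\<Sum>k<8. c k * p u ^ k)) \<in> O[at 0](\<lambda>u. u ^ 8)"
    using landau_o.big_trans[OF landau_o.big.compose[OF f(1)[unfolded has_jet_def] p_lim] landau_o.big_power[OF pO]] .
  have poly: "c 0 + c 4 * T4 u ^ 4 + c 5 * T3 u ^ 5 + c 6 * T2 u ^ 6 + c 7 * (s 1 * u) ^ 7 = (\<Sum>k<8. ?d ! k * u ^ k) + u ^ 8 * R u" for u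
    unfolding sum_lessThan_8 T4_def T3_def T2_def R_def by simp algebra
  have "(\<lambda>u. (f (p u) - (\<Sum>k<8. c k * p u ^ k)) + c 4 * (p u ^ 4 - T4 u ^ 4) + c 5 * (p u ^ 5 - T3 u ^ 5)
      + c 6 * (p u ^ 6 - T2 u ^ 6) + c 7 * (p u ^ 7 - (s 1 * u) ^ 7) + u ^ 8 * R u) \<in> O[at 0](\<lambda>u. u ^ 8)"
    by (intro sum_in_bigo(1) bigo_cmult main D4 D3 D2 D1 R)
  moreover have "(f (p u) - (\<Sum>k<8. c k * p u ^ k)) + c 4 * (p u ^ 4 - T4 u ^ 4) + c 5 * (p u ^ 5 - T3 u ^ 5)
      + c 6 * (p u ^ 6 - T2 u ^ 6) + c 7 * (p u ^ 7 - (s 1 * u) ^ 7) + u ^ 8 * R u = f (p u) - (\<Sum>k<8. ?d ! k * u ^ k)" for u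
  proof -
    have "(\<Sum>k<8. c k * p u ^ k) = c 0 + c 4 * p u ^ 4 + c 5 * p u ^ 5 + c 6 * p u ^ 6 + c 7 * p u ^ 7"
      unfolding sum_lessThan_8 using f(2-4) by simp
    with poly[of u] show ?thesis by (simp add: right_diff_distrib)
  qed
  ultimately show ?thesis unfolding has_jet_def by (simp only:)
qed

text \<open>Up to order 12 the perturbation turns u^4 into u^4 + 4a u^10 + 4b u^11 and u^5 into u^5
  + 5a u^11, while powers from the sixth on change only from order 12. Order 11 can thus be adjusted
  without disturbing orders 6 and 7.\<close>

lemma has_jet_compose_order7:
  fixes a b :: real
  assumes f: "has_jet 12 f c" and c: "c 1 = 0" "c 2 = 0" "c 3 = 0" "c 6 = 0" "c 7 = 0"
  shows "has_jet 12 (\<lambda>u. f (u + a * u ^ 7 + b * u ^ 8))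
     ((!) [c 0, 0, 0, 0, c 4, c 5, 0, 0, c 8, c 9, c 10 + 4 * a * c 4, c 11 + 4 * b * c 4 + 5 * a * c 5])"
    (is "has_jet 12 _ ((!) ?d)")
proof -
  define p where "p u = u + a * u ^ 7 + b * u ^ 8" for u
  have pm: "(\<lambda>u. p u - u) \<in> O[at 0](\<lambda>u. u ^ 7)"
  proof -
    have "(\<lambda>u. u ^ 7 * (a + b * u)) \<in> O[at 0](\<lambda>u. u ^ 7)"
      by (rule power_mult_bigo) (intro continuous_intros)
    moreover have "u ^ 7 * (a + b * u) = p u - u" for u by (simp add: p_def algebra_simps eval_nat_numeral)
    ultimately show ?thesis by (simp only:)
  qed
  have pO: "p \<in> O[at 0](\<lambda>u. u)"
  proof -
    have "(\<lambda>u. u ^ 1 * (1 + a * u ^ 6 + b * u ^ 7)) \<in> O[at 0](\<lambda>u. u ^ 1)"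
      by (rule power_mult_bigo) (intro continuous_intros)
    moreover have "u ^ 1 * (1 + a * u ^ 6 + b * u ^ 7) = p u" for u by (simp add: p_def algebra_simps eval_nat_numeral)
    ultimately show ?thesis by (simp only: power_one_right)
  qed
  have "has_jet 2 p ((!) [0, 1])"
  proof -
    have "(\<lambda>u. p u - u) \<in> O[at 0](\<lambda>u. u ^ 2)"
      by (rule landau_o.big_trans[OF pm power_bigo_power]) simp
    then show ?thesis by (simp add: has_jet_def eval_nat_numeral)
  qed
  then have p_lim: "filterlim p (at 0) (at 0)" by (rule has_jet_filterlim_at_0) simp_all
  have main: "(\<lambda>u. f (p u) - (\<Sum>k<12. c k * p u ^ k)) \<in> O[at 0](\<lambda>u. u ^ 12)"
    using landau_o.big_trans[OF landau_o.big.compose[OF f(1)[unfolded has_jet_def] p_lim] landau_o.big_power[OF pO]] .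
  have D: "(\<lambda>u. p u ^ k - u ^ k) \<in> O[at 0](\<lambda>u. u ^ 12)" if "k \<ge> 6" for k
  proof -
    obtain j where k: "k = Suc j" using \<open>k \<ge> 6\<close> by (cases k) auto
    have "(\<lambda>u. p u ^ k - u ^ k) \<in> O[at 0](\<lambda>u. u ^ (7 + j))"
      unfolding k by (rule power_diff_bigo[OF pm pO]) simp
    moreover have "(\<lambda>u::real. u ^ (7 + j)) \<in> O[at 0](\<lambda>u. u ^ 12)" by (rule power_bigo_power) (use that k in simp)
    ultimately show ?thesis by (rule landau_o.big_trans)
  qed
  define R where "R u = c 4 * (u ^ 4 * (a + b * u) ^ 2 * (6 + 4 * u ^ 6 * (a + b * u) + u ^ 12 * (a + b * u) ^ 2)) +
    c 5 * (5 * b + u ^ 5 * (a + b * u) ^ 2 * (10 + 10 * u ^ 6 * (a + b * u) + 5 * u ^ 12 * (a + b * u) ^ 2 + u ^ 18 * (a + b * u) ^ 3))" for u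
  have R: "(\<lambda>u. u ^ 12 * R u) \<in> O[at 0](\<lambda>u. u ^ 12)"
    by (rule power_mult_bigo) (unfold R_def, intro continuous_intros)
  have "(\<lambda>u. (f (p u) - (\<Sum>k<12. c k * p u ^ k)) + c 8 * (p u ^ 8 - u ^ 8) + c 9 * (p u ^ 9 - u ^ 9)
      + c 10 * (p u ^ 10 - u ^ 10) + c 11 * (p u ^ 11 - u ^ 11) + u ^ 12 * R u) \<in> O[at 0](\<lambda>u. u ^ 12)"
    by (intro sum_in_bigo(1) bigo_cmult main D R) simp_all
  moreover have "(f (p u) - (\<Sum>k<12. c k * p u ^ k)) + c 8 * (p u ^ 8 - u ^ 8) + c 9 * (p u ^ 9 - u ^ 9)
      + c 10 * (p u ^ 10 - u ^ 10) + c 11 * (p u ^ 11 - u ^ 11) + u ^ 12 * R u = f (p u) - (\<Sum>k<12. ?d ! k * u ^ k)" for u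
  proof -
    have "(\<Sum>k<12. c k * p u ^ k) = c 0 + c 4 * p u ^ 4 + c 5 * p u ^ 5 + c 8 * p u ^ 8 + c 9 * p u ^ 9 + c 10 * p u ^ 10 + c 11 * p u ^ 11"
      unfolding sum_lessThan_12 using c by simp
    moreover have "(\<Sum>k<12. ?d ! k * u ^ k) = c 0 + c 4 * u ^ 4 + c 5 * u ^ 5 + c 8 * u ^ 8 + c 9 * u ^ 9 +
       (c 10 + 4 * a * c 4) * u ^ 10 + (c 11 + 4 * b * c 4 + 5 * a * c 5) * u ^ 11"
      unfolding sum_lessThan_12 by simp
    moreover have "c 4 * p u ^ 4 + c 5 * p u ^ 5 = c 4 * u ^ 4 + c 5 * u ^ 5 + 4 * a * c 4 * u ^ 10 +
       (4 * b * c 4 + 5 * a * c 5) * u ^ 11 + u ^ 12 * R u"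
      unfolding p_def R_def by algebra
    ultimately show ?thesis by (simp add: algebra_simps)
  qed
  ultimately have "(\<lambda>u. f (p u) - (\<Sum>k<12. ?d ! k * u ^ k)) \<in> O[at 0](\<lambda>u. u ^ 12)" by (simp only:)
  then show ?thesis unfolding has_jet_def p_def .
qed

section \<open>Curves equivalent to the cusp\<close>

lemma has_jet_cong:
  assumes "has_jet N f c" "\<forall>\<^sub>F u in nhds 0. f u = g u"
  shows "has_jet N g c"
proof -
  have "\<forall>\<^sub>F u in at 0. f u - (\<Sum>k<N. c k * u ^ k) = g u - (\<Sum>k<N. c k * u ^ k)"
    using assms(2) unfolding eventually_at_filter by eventually_elim simp
  from landau_o.big.in_cong[OF this] show ?thesis using assms(1) unfolding has_jet_def by blast
qed

lemma smooth_on_tendsto_nhds: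
  assumes "open S" "x \<in> S" "smooth_on S f"
  shows "(f \<longlongrightarrow> f x) (nhds x)"
  using smooth_on_continuous[OF assms(3)] assms(1,2)
  by (simp add: continuous_on_eq_continuous_at isCont_def tendsto_at_iff_tendsto_nhds)

lemma cusp45_nth [simp]: "cusp45 u $ 1 = u ^ 4" "cusp45 u $ 2 = u ^ 5"
  by (simp_all add: cusp45_def)

lemma cusp45_0: "cusp45 0 = 0"
  by (simp add: vec_eq_iff forall_2)

lemma cusp45_tendsto_0: "(cusp45 \<longlongrightarrow> 0) (nhds 0)"
proof (rule vec_tendstoI)
  fix i :: 2
  have "((\<lambda>u::real. u ^ 4) \<longlongrightarrow> 0 ^ 4) (nhds 0)" "((\<lambda>u::real. u ^ 5) \<longlongrightarrow> 0 ^ 5) (nhds 0)"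
    by (intro tendsto_intros filterlim_ident)+
  then show "((\<lambda>u. cusp45 u $ i) \<longlongrightarrow> 0 $ i) (nhds 0)"
    using exhaust_2[of i] by auto
qed

text \<open>For |u| \<le> 1 the point of the cusp has norm at most 2 u^4, so all that follows the
  linear part of \<open>F\<close> has order at least 8, and orders 6 and 7 are empty.\<close>

lemma has_jet_compose_cusp45:
  fixes F :: "real^2 \<Rightarrow> real"
  assumes "open V" "0 \<in> V" "smooth_on V F"
  shows "has_jet 8 (\<lambda>u. F (cusp45 u)) ((!) [F 0, 0, 0, 0, pd (axis 1 1) F 0, pd (axis 2 1) F 0, 0, 0])"
proof -
  let ?p = "pd (axis 1 1) F 0" and ?q = "pd (axis 2 1) F 0"
  obtain K where "\<forall>\<^sub>F p in nhds 0. \<bar>F p - F 0 - (\<Sum>b\<in>Basis. (p \<bullet> b) * pd b F 0)\<bar> \<le> K * (norm p)\<^sup>2"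
    using smooth_first_order_bound[OF assms] .
  from eventually_compose_filterlim[OF this cusp45_tendsto_0]
  have "\<forall>\<^sub>F u in at 0. \<bar>F (cusp45 u) - F 0 - (u ^ 4 * ?p + u ^ 5 * ?q)\<bar> \<le> K * (norm (cusp45 u))\<^sup>2"
    by (simp add: eventually_at_filter sum_Basis_real2 inner_axis eventually_mono)
  moreover have "\<forall>\<^sub>F u in at (0::real). \<bar>u\<bar> \<le> 1" unfolding eventually_at by (intro exI[of _ 1]) auto
  ultimately have "\<forall>\<^sub>F u in at 0. norm (F (cusp45 u) - F 0 - (u ^ 4 * ?p + u ^ 5 * ?q)) \<le> (\<bar>K\<bar> * 4) * norm (u ^ 8)"
  proof eventually_elim
    case (elim u)
    have "\<bar>u ^ 5\<bar> \<le> \<bar>u ^ 4\<bar>" unfolding power_abs using elim(2) by (intro power_decreasing) simp_all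
    moreover have "norm (cusp45 u) \<le> \<bar>u ^ 4\<bar> + \<bar>u ^ 5\<bar>"
      using norm_le_l1_cart[of "cusp45 u"] by (simp add: sum_2)
    ultimately have "norm (cusp45 u) \<le> 2 * \<bar>u ^ 4\<bar>" by linarith
    then have "(norm (cusp45 u))\<^sup>2 \<le> (2 * \<bar>u ^ 4\<bar>)\<^sup>2" by (rule power_mono) simp
    also have "(2 * \<bar>u ^ 4\<bar>)\<^sup>2 = 4 * \<bar>u ^ 8\<bar>" by (simp add: power_mult_distrib power_abs flip: power_mult)
    finally have "\<bar>K\<bar> * (norm (cusp45 u))\<^sup>2 \<le> \<bar>K\<bar> * (4 * \<bar>u ^ 8\<bar>)" by (rule mult_left_mono) simp
    moreover have "K * (norm (cusp45 u))\<^sup>2 \<le> \<bar>K\<bar> * (norm (cusp45 u))\<^sup>2" by (rule mult_right_mono) auto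
    ultimately show ?case using elim(1) by simp
  qed
  then have "(\<lambda>u. F (cusp45 u) - F 0 - (u ^ 4 * ?p + u ^ 5 * ?q)) \<in> O[at 0](\<lambda>u. u ^ 8)" by (rule bigoI)
  moreover have "F (cusp45 u) - F 0 - (u ^ 4 * ?p + u ^ 5 * ?q) =
      F (cusp45 u) - (\<Sum>k<8. [F 0, 0, 0, 0, ?p, ?q, 0, 0] ! k * u ^ k)" for u
    unfolding sum_lessThan_8 by simp
  ultimately show ?thesis unfolding has_jet_def by (simp only:)
qed

lemma det2_lincomb: "det2 (a *\<^sub>R p + b *\<^sub>R q) (c *\<^sub>R p + d *\<^sub>R q) = (a * d - b * c) * det2 p q"
  by (simp add: det2_eq algebra_simps)

lemma det2_span:
  assumes "det2 p q \<noteq> 0"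
  obtains x y where "w = x *\<^sub>R p + y *\<^sub>R q"
proof
  show "w = (det2 w q / det2 p q) *\<^sub>R p + (det2 p w / det2 p q) *\<^sub>R q"
    using assms by (simp add: vec_eq_iff forall_2 divide_simps) (simp add: det2_eq algebra_simps)
qed

lemma diffeo_germ_sym: "diffeo_germ f g a b \<Longrightarrow> diffeo_germ g f b a"
  unfolding diffeo_germ_def by blast

lemma diffeo_germ_det2:
  fixes f :: "real^2 \<Rightarrow> real^2"
  assumes "diffeo_germ f g a b"
  shows "det2 (pd (axis 1 1) f a) (pd (axis 2 1) f a) \<noteq> 0"
proof
  let ?p = "pd (axis 1 1) f a" and ?q = "pd (axis 2 1) f a"
  assume det: "det2 ?p ?q = 0"
  have inj: "h = 0" if "h $ 1 *\<^sub>R ?p + h $ 2 *\<^sub>R ?q = 0" for h :: "real^2"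
    by (rule diffeo_germ_derivative_injective[OF assms]) (use that in \<open>simp add: sum_Basis_real2 inner_axis\<close>)
  \<comment> \<open>If the determinant vanishes, (q_i, -p_i) lies in the kernel of the derivative
    for each i. Injectivity forces p = 0, and then the first axis vector lies in the kernel as
    well.\<close>
  have "(vector [?q $ i, - ?p $ i] :: real^2) = 0" for i
    by (rule inj) (use det exhaust_2[of i] in \<open>auto simp: vec_eq_iff forall_2 det2_eq mult.commute\<close>)
  then have "?p $ i = 0" for i
    by (metis vector_2(2) zero_index neg_equal_0_iff_equal)
  then have "?p = 0" by (simp add: vec_eq_iff)
  then have "(axis 1 1 :: real^2) = 0" by (intro inj[of "axis 1 1"]) (simp add: axis_def)
  then show False by (simp add: axis_eq_0_iff)
qed

text \<open>Solving the equivalence for \<gamma> presents it near 0 as an explicit composition whose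
  jet can be computed.\<close>

lemma A_equivalent_cusp45_factor:
  assumes "open I" "0 \<in> I" "smooth_on I \<gamma>" "A_equivalent \<gamma> cusp45"
  obtains \<psi> \<psi>' \<Phi> \<Phi>' where "diffeo_germ \<psi> \<psi>' 0 0" "diffeo_germ \<Phi> \<Phi>' 0 (\<gamma> 0)"
    "\<forall>\<^sub>F s in nhds 0. \<Phi> (cusp45 (\<psi> s)) = \<gamma> s"
proof -
  obtain \<psi> \<psi>' \<Psi> \<Psi>' where psi: "diffeo_germ \<psi> \<psi>' 0 0" and Psi: "diffeo_germ \<Psi> \<Psi>' (\<gamma> 0) 0"
    and ev: "\<forall>\<^sub>F t in nhds 0. \<Psi> (\<gamma> (\<psi>' t)) = cusp45 t"
    using assms(4) unfolding A_equivalent_def cusp45_0 by blast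
  obtain U where U: "open U" "0 \<in> U" "smooth_on U \<psi>" "\<And>x. x \<in> U \<Longrightarrow> \<psi>' (\<psi> x) = x" "\<psi> 0 = 0"
    using psi unfolding diffeo_germ_def by blast
  obtain W where W: "open W" "\<gamma> 0 \<in> W" "\<And>x. x \<in> W \<Longrightarrow> \<Psi>' (\<Psi> x) = x"
    using Psi unfolding diffeo_germ_def by blast
  have "(\<psi> \<longlongrightarrow> 0) (nhds 0)" using smooth_on_tendsto_nhds[OF U(1-3)] U(5) by simp
  from eventually_compose_filterlim[OF ev this]
  have "\<forall>\<^sub>F s in nhds 0. \<Psi> (\<gamma> (\<psi>' (\<psi> s))) = cusp45 (\<psi> s)" .
  moreover have "\<forall>\<^sub>F s in nhds 0. s \<in> U" by (rule eventually_nhds_in_open[OF U(1,2)])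
  moreover have "\<forall>\<^sub>F s in nhds 0. \<gamma> s \<in> W"
    by (rule topological_tendstoD[OF smooth_on_tendsto_nhds[OF assms(1-3)] W(1,2)])
  ultimately have "\<forall>\<^sub>F s in nhds 0. \<Psi>' (cusp45 (\<psi> s)) = \<gamma> s"
    by eventually_elim (metis U(4) W(3))
  with psi diffeo_germ_sym[OF Psi] that show thesis by blast
qed

lemma A_equivalent_cusp45_imp:
  fixes \<gamma> :: "real \<Rightarrow> real^2"
  assumes "open I" "0 \<in> I" "smooth_on I \<gamma>" "A_equivalent \<gamma> cusp45"
  defines "A \<equiv> det2 (cderiv 5 \<gamma> 0) (cderiv 4 \<gamma> 0)"
      and "B \<equiv> det2 (cderiv 6 \<gamma> 0) (cderiv 4 \<gamma> 0)"
      and "C \<equiv> det2 (cderiv 7 \<gamma> 0) (cderiv 4 \<gamma> 0)"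
      and "D \<equiv> det2 (cderiv 6 \<gamma> 0) (cderiv 5 \<gamma> 0)"
  shows "cderiv 1 \<gamma> 0 = 0 \<and> cderiv 2 \<gamma> 0 = 0 \<and> cderiv 3 \<gamma> 0 = 0 \<and> A \<noteq> 0 \<and>
            -77 * B\<^sup>2 + 105 * A * D + 60 * A * C = 0"
proof -
  obtain \<psi> \<psi>' \<Phi> \<Phi>' where psi: "diffeo_germ \<psi> \<psi>' 0 0" and Phi: "diffeo_germ \<Phi> \<Phi>' 0 (\<gamma> 0)"
    and ev: "\<forall>\<^sub>F s in nhds 0. \<Phi> (cusp45 (\<psi> s)) = \<gamma> s"
    using A_equivalent_cusp45_factor[OF assms(1-4)] .
  obtain U where U: "open U" "0 \<in> U" "smooth_on U \<psi>" and psi0: "\<psi> 0 = 0"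
    using psi unfolding diffeo_germ_def by blast
  obtain V where V: "open V" "0 \<in> V" "smooth_on V \<Phi>"
    using Phi unfolding diffeo_germ_def by blast
  define P where "P = pd (axis 1 1) \<Phi> 0"
  define Q where "Q = pd (axis 2 1) \<Phi> 0"
  have PQ: "det2 P Q \<noteq> 0" unfolding P_def Q_def by (rule diffeo_germ_det2[OF Phi])
  define s where "s k = cderiv k \<psi> 0 / fact k" for k
  have s: "has_jet 5 \<psi> s" unfolding s_def by (rule smooth_on_has_jet[OF U])
  have s0: "s 0 = 0" by (simp add: s_def psi0)
  have s1: "s 1 \<noteq> 0"
  proof
    assume "s 1 = 0"
    then have "pd 1 \<psi> 0 = 0" by (simp add: s_def cderiv_Suc)
    then have "(1::real) = 0" using diffeo_germ_derivative_injective[OF psi, of 1] by simp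
    then show False by simp
  qed
  let ?d = "\<lambda>i. [\<Phi> 0 $ i, 0, 0, 0, P $ i * s 1 ^ 4, P $ i * (4 * s 1 ^ 3 * s 2) + Q $ i * s 1 ^ 5,
     P $ i * (4 * s 1 ^ 3 * s 3 + 6 * s 1 ^ 2 * s 2 ^ 2) + Q $ i * (5 * s 1 ^ 4 * s 2),
     P $ i * (4 * s 1 ^ 3 * s 4 + 12 * s 1 ^ 2 * s 2 * s 3 + 4 * s 1 * s 2 ^ 3) +
       Q $ i * (5 * s 1 ^ 4 * s 3 + 10 * s 1 ^ 3 * s 2 ^ 2)]"
  have jet: "has_jet 8 (\<lambda>t. \<gamma> t $ i) ((!) (?d i))" for i
  proof -
    have sm: "smooth_on V (\<lambda>p. \<Phi> p $ i)" using V(3) unfolding smooth_on_vec_nth[OF V(1), of \<Phi>] by blast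
    have "pd (axis 1 1) (\<lambda>p. \<Phi> p $ i) 0 = P $ i" "pd (axis 2 1) (\<lambda>p. \<Phi> p $ i) 0 = Q $ i"
      unfolding P_def Q_def by (rule pd_vec_nth[OF V(3) _ V(2)]; simp add: Basis_real2)+
    with has_jet_compose_cusp45[OF V(1,2) sm]
    have "has_jet 8 (\<lambda>u. \<Phi> (cusp45 u) $ i) ((!) [\<Phi> 0 $ i, 0, 0, 0, P $ i, Q $ i, 0, 0])" by simp
    from has_jet_compose_order4[OF this _ _ _ s s0 s1]
    have "has_jet 8 (\<lambda>u. \<Phi> (cusp45 (\<psi> u)) $ i) ((!) (?d i))" by simp
    moreover have "\<forall>\<^sub>F u in nhds 0. \<Phi> (cusp45 (\<psi> u)) $ i = \<gamma> u $ i"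
      using ev by eventually_elim simp
    ultimately show ?thesis by (rule has_jet_cong)
  qed
  have cd: "cderiv k \<gamma> 0 $ i = fact k * ?d i ! k" if "k < 8" for k i
  proof -
    have "smooth_on I (\<lambda>t. \<gamma> t $ i)" using assms(3) unfolding smooth_on_vec_nth[OF assms(1), of \<gamma>] by blast
    from cderiv_eq_if_has_jet[OF assms(1,2) this jet that]
    show ?thesis by (simp only: cderiv_vec_nth[OF assms(1,3,2)])
  qed
  have low: "cderiv 1 \<gamma> 0 = 0" "cderiv 2 \<gamma> 0 = 0" "cderiv 3 \<gamma> 0 = 0"
    by (simp_all add: vec_eq_iff cd)
  have g4: "cderiv 4 \<gamma> 0 = (24 * s 1 ^ 4) *\<^sub>R P + 0 *\<^sub>R Q"
    by (simp add: vec_eq_iff cd fact_numeral algebra_simps)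
  have g5: "cderiv 5 \<gamma> 0 = (480 * s 1 ^ 3 * s 2) *\<^sub>R P + (120 * s 1 ^ 5) *\<^sub>R Q"
    by (simp add: vec_eq_iff cd fact_numeral algebra_simps)
  have g6: "cderiv 6 \<gamma> 0 = (720 * (4 * s 1 ^ 3 * s 3 + 6 * s 1 ^ 2 * s 2 ^ 2)) *\<^sub>R P + (3600 * s 1 ^ 4 * s 2) *\<^sub>R Q"
    by (simp add: vec_eq_iff cd fact_numeral algebra_simps)
  have g7: "cderiv 7 \<gamma> 0 = (5040 * (4 * s 1 ^ 3 * s 4 + 12 * s 1 ^ 2 * s 2 * s 3 + 4 * s 1 * s 2 ^ 3)) *\<^sub>R P
     + (5040 * (5 * s 1 ^ 4 * s 3 + 10 * s 1 ^ 3 * s 2 ^ 2)) *\<^sub>R Q"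
    by (simp add: vec_eq_iff cd fact_numeral algebra_simps)
  have A: "A = - 2880 * s 1 ^ 9 * det2 P Q"
    unfolding A_def g4 g5 det2_lincomb by (simp flip: power_add)
  have B: "B = - 86400 * s 1 ^ 8 * s 2 * det2 P Q"
    unfolding B_def g4 g6 det2_lincomb by (simp flip: power_add)
  have C: "C = - 120960 * s 1 ^ 4 * (5 * s 1 ^ 4 * s 3 + 10 * s 1 ^ 3 * s 2 ^ 2) * det2 P Q"
    unfolding C_def g4 g7 det2_lincomb by (simp add: algebra_simps)
  have D: "D = 86400 * (4 * s 1 ^ 8 * s 3 - 14 * s 1 ^ 7 * s 2 ^ 2) * det2 P Q"
    unfolding D_def g5 g6 det2_lincomb by algebra
  have "A \<noteq> 0" using A s1 PQ by simp
  \<comment> \<open>An identity in \<open>s 1\<close>, \<open>s 2\<close>, \<open>s 3\<close> times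
    the square of \<open>det2 P Q\<close>. The coefficient \<open>s 4\<close> has dropped out: it
    occurs only in the \<open>P\<close> component of the seventh derivative, parallel to the
    fourth.\<close>
  moreover have "-77 * B\<^sup>2 + 105 * A * D + 60 * A * C = 0"
    unfolding A B C D by algebra
  ultimately show ?thesis using low by blast
qed

section \<open>Sufficiency: normalising the parameter and constructing the diffeomorphism of the
  plane\<close>

lemma has_partial_vecI:
  fixes f :: "'a::euclidean_space \<Rightarrow> real^'n"
  assumes "\<And>i. has_partial v (\<lambda>x. f x $ i) (d $ i) x"
  shows "has_partial v f d x"
  by (rule has_partial_componentwise[of v f d x]) (use assms in \<open>auto simp: Basis_vec_def inner_axis\<close>)

text \<open>Each component of the curve is a sum of u^(5j) b_j (u^4). Reading u^4 and u^5 as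
  independent coordinates x and y gives the map with components sum of y^j b_j (x); its Jacobian
  columns at 0 are the Taylor vectors of orders 4 and 5.\<close>

lemma A_equivalent_cusp45_if_gaps:
  fixes \<gamma> :: "real \<Rightarrow> real^2" and \<sigma> :: "real \<Rightarrow> real"
  assumes S: "open S" "0 \<in> S"
    and sigma: "smooth_on S \<sigma>" "\<sigma> 0 = 0" "cderiv 1 \<sigma> 0 \<noteq> 0"
    and f: "smooth_on S (\<lambda>u. \<gamma> (\<sigma> u))"
    and gaps: "\<And>k. k \<in> {1, 2, 3, 6, 7, 11} \<Longrightarrow> cderiv k (\<lambda>u. \<gamma> (\<sigma> u)) 0 = 0"
    and indep: "det2 (cderiv 4 (\<lambda>u. \<gamma> (\<sigma> u)) 0) (cderiv 5 (\<lambda>u. \<gamma> (\<sigma> u)) 0) \<noteq> 0"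
  shows "A_equivalent \<gamma> cusp45"
proof -
  let ?f = "\<lambda>u. \<gamma> (\<sigma> u)"
  obtain r where r: "r > 0" "{-r<..<r} \<subseteq> S"
    using S by (metis open_contains_ball ball_eq_greaterThanLessThan diff_0 add_0)
  let ?T = "{-(r^4)<..<r^4}"
  have fi: "smooth_on S (\<lambda>u. ?f u $ i)" for i using f unfolding smooth_on_vec_nth[OF S(1), of ?f] by blast
  have cd: "cderiv k (\<lambda>u. ?f u $ i) 0 = cderiv k ?f 0 $ i" for k i by (rule cderiv_vec_nth[OF S(1) f S(2)])
  have "\<forall>i. \<exists>b::nat \<Rightarrow> real \<Rightarrow> real. (\<forall>j. smooth_on ?T (b j)) \<and>
      (\<forall>u\<in>{-r<..<r}. ?f u $ i = b 0 (u^4) + u^5 * b 1 (u^4) + u^10 * b 2 (u^4) + u^15 * b 3 (u^4)) \<and>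
      (b 0 has_real_derivative cderiv 4 ?f 0 $ i / fact 4) (at 0) \<and> b 1 0 = cderiv 5 ?f 0 $ i / fact 5"
  proof
    fix i
    have "cderiv k (\<lambda>u. ?f u $ i) 0 = 0" if "k \<in> {1, 2, 3, 6, 7, 11}" for k
      using gaps[OF that] by (simp add: cd)
    from smooth_factor_through_4_5[OF r(1) smooth_on_subset[OF fi r(2)] this]
    obtain b0 b1 b2 b3 where "smooth_on ?T b0" "smooth_on ?T b1" "smooth_on ?T b2" "smooth_on ?T b3"
      "\<And>u. u \<in> {-r<..<r} \<Longrightarrow> ?f u $ i = b0 (u^4) + u^5 * b1 (u^4) + u^10 * b2 (u^4) + u^15 * b3 (u^4)"
      "(b0 has_real_derivative cderiv 4 ?f 0 $ i / fact 4) (at 0)" "b1 0 = cderiv 5 ?f 0 $ i / fact 5"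
      unfolding cd by blast
    then show "\<exists>b::nat \<Rightarrow> real \<Rightarrow> real. (\<forall>j. smooth_on ?T (b j)) \<and>
      (\<forall>u\<in>{-r<..<r}. ?f u $ i = b 0 (u^4) + u^5 * b 1 (u^4) + u^10 * b 2 (u^4) + u^15 * b 3 (u^4)) \<and>
      (b 0 has_real_derivative cderiv 4 ?f 0 $ i / fact 4) (at 0) \<and> b 1 0 = cderiv 5 ?f 0 $ i / fact 5"
      by (intro exI[of _ "\<lambda>j. if j = 0 then b0 else if j = 1 then b1 else if j = 2 then b2 else b3"]) simp
  qed
  from choice[OF this] obtain b :: "2 \<Rightarrow> nat \<Rightarrow> real \<Rightarrow> real" where B: "\<forall>i. (\<forall>j. smooth_on ?T (b i j)) \<and>
      (\<forall>u\<in>{-r<..<r}. ?f u $ i = b i 0 (u^4) + u^5 * b i 1 (u^4) + u^10 * b i 2 (u^4) + u^15 * b i 3 (u^4)) \<and>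
      (b i 0 has_real_derivative cderiv 4 ?f 0 $ i / fact 4) (at 0) \<and> b i 1 0 = cderiv 5 ?f 0 $ i / fact 5" ..
  have b: "\<And>i j. smooth_on ?T (b i j)"
    and bf: "\<And>i u. u \<in> {-r<..<r} \<Longrightarrow> ?f u $ i = b i 0 (u^4) + u^5 * b i 1 (u^4) + u^10 * b i 2 (u^4) + u^15 * b i 3 (u^4)"
    and b0': "\<And>i. (b i 0 has_real_derivative cderiv 4 ?f 0 $ i / fact 4) (at 0)"
    and b10: "\<And>i. b i 1 0 = cderiv 5 ?f 0 $ i / fact 5"
    using B by simp_all
  define \<Phi> :: "real^2 \<Rightarrow> real^2" where
    "\<Phi> p = (\<chi> i. b i 0 (p$1) + p$2 * b i 1 (p$1) + (p$2)^2 * b i 2 (p$1) + (p$2)^3 * b i 3 (p$1))" for p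
  \<comment> \<open>A strip: \<open>\<Phi>\<close> is polynomial in the second coordinate, so only
    the first has to stay where the functions \<open>b i j\<close> are smooth.\<close>
  define U where "U = {p::real^2. p $ 1 \<in> ?T}"
  have U: "open U" "0 \<in> U"
  proof -
    have "U = (\<lambda>p. p $ 1) -` ?T" by (auto simp: U_def)
    then show "open U" by (simp only:) (intro open_vimage continuous_intros open_greaterThanLessThan)
    show "0 \<in> U" using r(1) by (simp add: U_def)
  qed
  have nth: "smooth_on U (\<lambda>p. p $ i)" for i
    using smooth_on_inner_const[OF U(1), of "axis i 1"] by (simp add: inner_axis)
  have comp: "smooth_on U (\<lambda>p. h (p $ 1))" if "smooth_on ?T h" for h :: "real \<Rightarrow> real"
    by (rule smooth_on_compose[OF open_greaterThanLessThan U(1) _ that nth]) (auto simp: U_def)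
  have smooth: "smooth_on U \<Phi>"
    unfolding smooth_on_vec_nth[OF U(1), of \<Phi>] \<Phi>_def
    by (simp, intro allI smooth_on_add smooth_on_mult smooth_on_power nth comp b U(1))
  have "has_partial (axis 1 1) \<Phi> ((1 / fact 4) *\<^sub>R cderiv 4 ?f 0) 0"
  proof (rule has_partial_vecI)
    fix i
    show "has_partial (axis 1 1) (\<lambda>p. \<Phi> p $ i) (((1 / fact 4) *\<^sub>R cderiv 4 ?f 0) $ i) 0"
      using b0'[of i] unfolding has_partial_def \<Phi>_def has_real_derivative_iff_has_vector_derivative
      by (simp add: axis_def)
  qed
  then have P: "pd (axis 1 1) \<Phi> 0 = (1 / fact 4) *\<^sub>R cderiv 4 ?f 0" by (rule has_partial_imp_pd)
  have "has_partial (axis 2 1) \<Phi> ((1 / fact 5) *\<^sub>R cderiv 5 ?f 0) 0"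
  proof (rule has_partial_vecI)
    fix i
    have "((\<lambda>t. b i 0 0 + t * b i 1 0 + t^2 * b i 2 0 + t^3 * b i 3 0) has_real_derivative b i 1 0) (at 0)"
      by (auto intro!: derivative_eq_intros)
    then show "has_partial (axis 2 1) (\<lambda>p. \<Phi> p $ i) (((1 / fact 5) *\<^sub>R cderiv 5 ?f 0) $ i) 0"
      unfolding has_partial_def \<Phi>_def has_real_derivative_iff_has_vector_derivative
      using b10[of i] by (simp add: axis_def)
  qed
  then have Q: "pd (axis 2 1) \<Phi> 0 = (1 / fact 5) *\<^sub>R cderiv 5 ?f 0" by (rule has_partial_imp_pd)
  have "det2 (pd (axis 1 1) \<Phi> 0) (pd (axis 2 1) \<Phi> 0) \<noteq> 0"
    using indep unfolding P Q by (simp add: det2_eq)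
  from smooth_inverse_function_real2[OF U smooth this]
  obtain \<Psi> where Psi: "diffeo_germ \<Psi> \<Phi> (\<Phi> 0) 0" .
  obtain \<psi> where psi: "diffeo_germ \<psi> \<sigma> (\<sigma> 0) 0"
    using smooth_inverse_function_real[OF S sigma(1,3)] .
  have cusp: "\<gamma> (\<sigma> t) = \<Phi> (cusp45 t)" if "t \<in> {-r<..<r}" for t
    using bf[OF that] by (simp add: vec_eq_iff \<Phi>_def flip: power_mult)
  have Phi0: "\<Phi> 0 = \<gamma> 0" using cusp[of 0] r(1) sigma(2) by (simp add: cusp45_0)
  obtain V where V: "open V" "0 \<in> V" "\<And>y. y \<in> V \<Longrightarrow> \<Psi> (\<Phi> y) = y"
    using Psi unfolding diffeo_germ_def by blast
  have "\<forall>\<^sub>F t in nhds 0. t \<in> {-r<..<r}" using r(1) by (intro eventually_nhds_in_open) auto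
  moreover have "\<forall>\<^sub>F t in nhds 0. cusp45 t \<in> V"
    by (rule topological_tendstoD[OF cusp45_tendsto_0 V(1,2)])
  ultimately have "\<forall>\<^sub>F t in nhds 0. \<Psi> (\<gamma> (\<sigma> t)) = cusp45 t"
    by eventually_elim (simp only: cusp V(3))
  \<comment> \<open>In the definition of equivalence \<sigma> takes the role of the inverse
    parameter change, and its local inverse that of the change itself.\<close>
  then show ?thesis
    unfolding A_equivalent_def using psi Psi sigma(2) Phi0 cusp45_0 by metis
qed

lemma has_jet_vec:
  fixes f :: "real \<Rightarrow> real^'n"
  assumes "open S" "0 \<in> S" "smooth_on S f"
  shows "has_jet N (\<lambda>u. f u $ i) (\<lambda>k. cderiv k f 0 $ i / fact k)"
proof -
  have "smooth_on S (\<lambda>u. f u $ i)" using assms(3) unfolding smooth_on_vec_nth[OF assms(1), of f] by blast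
  from smooth_on_has_jet[OF assms(1,2) this] show ?thesis
    by (simp only: cderiv_vec_nth[OF assms(1,3,2)])
qed

lemma cderiv_vec_eq_if_has_jet:
  fixes f :: "real \<Rightarrow> real^'n"
  assumes "open S" "0 \<in> S" "smooth_on S f" "has_jet N (\<lambda>u. f u $ i) c" "k < N"
  shows "cderiv k f 0 $ i = fact k * c k"
  using has_jet_unique[OF has_jet_vec[OF assms(1-3)] assms(4,5)] by (simp add: field_simps)

lemma smooth_on_compose_vec:
  fixes f :: "real \<Rightarrow> real^'n" and p :: "real \<Rightarrow> real"
  assumes "open I" "smooth_on I f" "smooth_on UNIV p"
  shows "open (p -` I)" "smooth_on (p -` I) (\<lambda>u. f (p u))"
proof -
  show o: "open (p -` I)" by (rule open_vimage[OF assms(1) smooth_on_continuous[OF assms(3)]])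
  have "smooth_on (p -` I) (\<lambda>u. f (p u) $ i)" for i
  proof (rule smooth_on_compose[OF assms(1) o, of p "\<lambda>y. f y $ i"])
    show "smooth_on I (\<lambda>u. f u $ i)" using assms(2) unfolding smooth_on_vec_nth[OF assms(1), of f] by blast
    show "smooth_on (p -` I) p" by (rule smooth_on_subset[OF assms(3)]) simp
  qed auto
  then show "smooth_on (p -` I) (\<lambda>u. f (p u))"
    unfolding smooth_on_vec_nth[OF o, of "\<lambda>u. f (p u)"] by blast
qed

lemma reparametrise_remove_order_11:
  fixes g :: "real \<Rightarrow> real^2"
  assumes S: "open S" "0 \<in> S" "smooth_on S g"
    and z: "\<And>k. k \<in> {1, 2, 3, 6, 7} \<Longrightarrow> cderiv k g 0 = 0"
    and indep: "det2 (cderiv 4 g 0) (cderiv 5 g 0) \<noteq> 0"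
  obtains a b :: real where
    "\<And>k. k \<in> {1, 2, 3, 6, 7, 11} \<Longrightarrow> cderiv k (\<lambda>u. g (u + a * u ^ 7 + b * u ^ 8)) 0 = 0"
    "det2 (cderiv 4 (\<lambda>u. g (u + a * u ^ 7 + b * u ^ 8)) 0) (cderiv 5 (\<lambda>u. g (u + a * u ^ 7 + b * u ^ 8)) 0) \<noteq> 0"
proof -
  obtain x y where xy: "cderiv 11 g 0 = x *\<^sub>R cderiv 4 g 0 + y *\<^sub>R cderiv 5 g 0"
    using det2_span[OF indep] .
  \<comment> \<open>The order-11 coefficient of the new jet is w_11 + 4b w_4 + 5a w_5 in Taylor
    vectors. As w_4 and w_5 form a basis, the two numbers can cancel both coordinates; the
    factorials convert derivatives into Taylor coefficients.\<close>
  define a where "a = - y * fact 5 / (5 * fact 11)"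
  define b where "b = - x * fact 4 / (4 * fact 11)"
  let ?p = "\<lambda>u. u + a * u ^ 7 + b * u ^ 8"
  have p: "smooth_on UNIV ?p"
    by (intro smooth_on_add smooth_on_mult smooth_on_const smooth_on_power smooth_on_ident_real) auto
  let ?W = "?p -` S"
  have W: "open ?W" "smooth_on ?W (\<lambda>u. g (?p u))" by (rule smooth_on_compose_vec[OF S(1,3) p])+
  have W0: "0 \<in> ?W" using S(2) by simp
  let ?c = "\<lambda>i k. cderiv k g 0 $ i / fact k"
  let ?d = "\<lambda>i. [?c i 0, 0, 0, 0, ?c i 4, ?c i 5, 0, 0, ?c i 8, ?c i 9, ?c i 10 + 4 * a * ?c i 4, ?c i 11 + 4 * b * ?c i 4 + 5 * a * ?c i 5]"
  have "has_jet 12 (\<lambda>u. g (?p u) $ i) ((!) (?d i))" for i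
    by (rule has_jet_compose_order7[OF has_jet_vec[OF S]]) (simp_all add: z)
  from cderiv_vec_eq_if_has_jet[OF W(1) W0 W(2) this]
  have cd: "cderiv k (\<lambda>u. g (?p u)) 0 $ i = fact k * ?d i ! k" if "k < 12" for k i
    using that by blast
  have "?c i 11 + 4 * b * ?c i 4 + 5 * a * ?c i 5 = 0" for i
    unfolding xy by (simp add: a_def b_def field_simps)
  then have "cderiv k (\<lambda>u. g (?p u)) 0 = 0" if "k \<in> {1, 2, 3, 6, 7, 11}" for k
    using that by (auto simp: vec_eq_iff cd)
  moreover have "cderiv 4 (\<lambda>u. g (?p u)) 0 = cderiv 4 g 0" "cderiv 5 (\<lambda>u. g (?p u)) 0 = cderiv 5 g 0"
    by (simp_all add: vec_eq_iff cd)
  ultimately show thesis using that[of a b] indep by simp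
qed

lemma A_equivalent_cusp45_if:
  fixes \<gamma> :: "real \<Rightarrow> real^2"
  assumes I: "open I" "0 \<in> I" "smooth_on I \<gamma>"
    and low: "cderiv 1 \<gamma> 0 = 0" "cderiv 2 \<gamma> 0 = 0" "cderiv 3 \<gamma> 0 = 0"
  defines "A \<equiv> det2 (cderiv 5 \<gamma> 0) (cderiv 4 \<gamma> 0)"
      and "B \<equiv> det2 (cderiv 6 \<gamma> 0) (cderiv 4 \<gamma> 0)"
      and "C \<equiv> det2 (cderiv 7 \<gamma> 0) (cderiv 4 \<gamma> 0)"
      and "D \<equiv> det2 (cderiv 6 \<gamma> 0) (cderiv 5 \<gamma> 0)"
  assumes A: "A \<noteq> 0" and eq: "-77 * B\<^sup>2 + 105 * A * D + 60 * A * C = 0"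
  shows "A_equivalent \<gamma> cusp45"
proof -
  \<comment> \<open>In the basis \<open>w 4\<close>, \<open>w 5\<close> of Taylor vectors, B, C and
    D become the coordinates y6, y7 and x6 up to numerical factors and \<delta>.\<close>
  define w where "w k = (1 / fact k) *\<^sub>R cderiv k \<gamma> 0" for k
  have g: "cderiv k \<gamma> 0 = fact k *\<^sub>R w k" for k by (simp add: w_def)
  define \<delta> where "\<delta> = det2 (w 4) (w 5)"
  have A': "A = - 2880 * \<delta>" by (simp add: A_def g \<delta>_def det2_eq fact_numeral algebra_simps)
  with A have d0: "\<delta> \<noteq> 0" by simp
  then have span: "\<exists>x y. v = x *\<^sub>R w 4 + y *\<^sub>R w 5" for v
    unfolding \<delta>_def using det2_span by metis
  obtain x6 y6 where w6: "w 6 = x6 *\<^sub>R w 4 + y6 *\<^sub>R w 5" using span by blast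
  obtain x7 y7 where w7: "w 7 = x7 *\<^sub>R w 4 + y7 *\<^sub>R w 5" using span by blast
  have B': "B = - 17280 * y6 * \<delta>"
    by (simp add: B_def g w6 \<delta>_def det2_eq fact_numeral algebra_simps)
  have C': "C = - 120960 * y7 * \<delta>"
    by (simp add: C_def g w7 \<delta>_def det2_eq fact_numeral algebra_simps)
  have D': "D = 86400 * x6 * \<delta>"
    by (simp add: D_def g w6 \<delta>_def det2_eq fact_numeral algebra_simps)
  \<comment> \<open>The constant is 60 * 2880 * 120960; dividing 105 * 2880 * 86400 and 77 * 17280^2
    by it gives 5/4 and 11/10.\<close>
  have "-77 * B\<^sup>2 + 105 * A * D + 60 * A * C = 20901888000 * \<delta>\<^sup>2 * (y7 - 5/4 * x6 - 11/10 * y6\<^sup>2)"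
    unfolding A' B' C' D' by (simp add: power2_eq_square algebra_simps)
  with eq d0 have y7: "y7 = 5/4 * x6 + 11/10 * y6\<^sup>2" by simp
  \<comment> \<open>\<open>s2\<close> and \<open>s3\<close> cancel the \<open>w 5\<close> and
    \<open>w 4\<close> components in order 6, and \<open>s4\<close> cancels the \<open>w 4\<close>
    component in order 7. The linear coefficient is normalised to 1.\<close>
  define s2 where "s2 = - y6 / 5"
  define s3 where "s3 = - (6 * s2\<^sup>2 + x6) / 4"
  define s4 where "s4 = - (12 * s2 * s3 + 4 * s2 ^ 3 + 6 * x6 * s2 + x7) / 4"
  let ?s = "(!) [0, 1, s2, s3, s4]"
  define \<tau> where "\<tau> u = u + s2 * u ^ 2 + s3 * u ^ 3 + s4 * u ^ 4" for u
  have tau_jet: "has_jet 5 \<tau> ?s"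
    by (simp add: has_jet_def \<tau>_def eval_nat_numeral)
  have tau: "smooth_on UNIV \<tau>" unfolding \<tau>_def
    by (intro smooth_on_add smooth_on_mult smooth_on_const smooth_on_power smooth_on_ident_real) auto
  define g where "g u = \<gamma> (\<tau> u)" for u
  let ?W = "\<tau> -` I"
  have W: "open ?W" "smooth_on ?W g" unfolding g_def by (rule smooth_on_compose_vec[OF I(1,3) tau])+
  have W0: "0 \<in> ?W" using I(2) by (simp add: \<tau>_def)
  let ?c = "\<lambda>i k. cderiv k \<gamma> 0 $ i / fact k"
  have c: "?c i k = w k $ i" for i k by (simp add: w_def)
  let ?d = "\<lambda>i. [\<gamma> 0 $ i, 0, 0, 0, w 4 $ i, w 4 $ i * (4 * s2) + w 5 $ i,
     w 4 $ i * (4 * s3 + 6 * s2 ^ 2) + w 5 $ i * (5 * s2) + w 6 $ i,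
     w 4 $ i * (4 * s4 + 12 * s2 * s3 + 4 * s2 ^ 3) +
       w 5 $ i * (5 * s3 + 10 * s2 ^ 2) + w 6 $ i * (6 * s2) + w 7 $ i]"
  have jet: "has_jet 8 (\<lambda>u. g u $ i) ((!) (?d i))" for i
    using has_jet_compose_order4[OF has_jet_vec[OF I, of 8 i] _ _ _ tau_jet] low
    unfolding g_def c by (simp add: w_def)
  have cd: "cderiv k g 0 $ i = fact k * ?d i ! k" if "k < 8" for k i
    by (rule cderiv_vec_eq_if_has_jet[OF W(1) W0 W(2) jet that])
  have d6: "w 4 $ i * (4 * s3 + 6 * s2 ^ 2) + w 5 $ i * (5 * s2) + w 6 $ i = 0" for i
    unfolding w6 by (simp add: s3_def s2_def field_simps)
  have d7: "w 4 $ i * (4 * s4 + 12 * s2 * s3 + 4 * s2 ^ 3) +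
       w 5 $ i * (5 * s3 + 10 * s2 ^ 2) + w 6 $ i * (6 * s2) + w 7 $ i = 0" for i
  proof -
    have "4 * s4 + 12 * s2 * s3 + 4 * s2 ^ 3 + 6 * x6 * s2 + x7 = 0" by (simp add: s4_def field_simps)
    \<comment> \<open>For the \<open>w 5\<close> component in order 7 no free coefficient is left;
      it vanishes by the relation \<open>y7\<close>, which is the hypothesis on the
      determinants.\<close>
    moreover have "5 * s3 + 10 * s2 ^ 2 + 6 * y6 * s2 + y7 = 0"
      by (simp add: s3_def s2_def y7 field_simps power2_eq_square)
    moreover have "w 4 $ i * (4 * s4 + 12 * s2 * s3 + 4 * s2 ^ 3) +
       w 5 $ i * (5 * s3 + 10 * s2 ^ 2) + w 6 $ i * (6 * s2) + w 7 $ i =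
       w 4 $ i * (4 * s4 + 12 * s2 * s3 + 4 * s2 ^ 3 + 6 * x6 * s2 + x7) + w 5 $ i * (5 * s3 + 10 * s2 ^ 2 + 6 * y6 * s2 + y7)"
      unfolding w6 w7 by (simp add: algebra_simps)
    ultimately show ?thesis by simp
  qed
  have z: "cderiv k g 0 = 0" if "k \<in> {1, 2, 3, 6, 7}" for k
    using that d6 d7 by (auto simp: vec_eq_iff cd)
  have "cderiv 4 g 0 = 24 *\<^sub>R w 4 + 0 *\<^sub>R w 5" "cderiv 5 g 0 = (480 * s2) *\<^sub>R w 4 + 120 *\<^sub>R w 5"
    by (simp_all add: vec_eq_iff cd fact_numeral)
  then have "det2 (cderiv 4 g 0) (cderiv 5 g 0) \<noteq> 0"
    using d0 unfolding \<delta>_def by (simp only: det2_lincomb) simp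
  from reparametrise_remove_order_11[OF W(1) W0 W(2) z this] obtain a b where
    gaps: "\<And>k. k \<in> {1, 2, 3, 6, 7, 11} \<Longrightarrow> cderiv k (\<lambda>u. g (u + a * u ^ 7 + b * u ^ 8)) 0 = 0"
    and indep: "det2 (cderiv 4 (\<lambda>u. g (u + a * u ^ 7 + b * u ^ 8)) 0) (cderiv 5 (\<lambda>u. g (u + a * u ^ 7 + b * u ^ 8)) 0) \<noteq> 0"
    by blast
  define \<rho> where "\<rho> u = u + a * u ^ 7 + b * u ^ 8" for u
  have rho: "smooth_on UNIV \<rho>" unfolding \<rho>_def
    by (intro smooth_on_add smooth_on_mult smooth_on_const smooth_on_power smooth_on_ident_real) auto
  let ?\<sigma> = "\<lambda>u. \<tau> (\<rho> u)"
  have sigma: "smooth_on UNIV ?\<sigma>"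
    by (rule smooth_on_compose[OF open_UNIV open_UNIV _ tau rho]) simp
  have "(?\<sigma> has_real_derivative 1) (at 0)"
    unfolding \<tau>_def \<rho>_def by (auto intro!: derivative_eq_intros)
  then have "cderiv 1 ?\<sigma> 0 = 1"
    by (simp add: cderiv_Suc has_partial_imp_pd has_partial_one_iff has_real_derivative_iff_has_vector_derivative)
  moreover have "open (?\<sigma> -` I)" "smooth_on (?\<sigma> -` I) (\<lambda>u. \<gamma> (?\<sigma> u))"
    by (rule smooth_on_compose_vec[OF I(1,3) sigma])+
  ultimately show ?thesis
    using gaps indep I(2) smooth_on_subset[OF sigma, of "?\<sigma> -` I"]
    by (intro A_equivalent_cusp45_if_gaps[of "?\<sigma> -` I" ?\<sigma>]) (simp_all add: g_def \<rho>_def \<tau>_def)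
qed

theorem mainTheorem8:
  fixes \<gamma> :: "real \<Rightarrow> real^2" and I :: "real set"
  assumes "open I" and "is_interval I" and "0 \<in> I" and "smooth_on I \<gamma>"
  defines "A \<equiv> det2 (cderiv 5 \<gamma> 0) (cderiv 4 \<gamma> 0)"
      and "B \<equiv> det2 (cderiv 6 \<gamma> 0) (cderiv 4 \<gamma> 0)"
      and "C \<equiv> det2 (cderiv 7 \<gamma> 0) (cderiv 4 \<gamma> 0)"
      and "D \<equiv> det2 (cderiv 6 \<gamma> 0) (cderiv 5 \<gamma> 0)"
  shows "A_equivalent \<gamma> cusp45 \<longleftrightarrow>
           (cderiv 1 \<gamma> 0 = 0 \<and> cderiv 2 \<gamma> 0 = 0 \<and> cderiv 3 \<gamma> 0 = 0 \<and> A \<noteq> 0 \<and>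
            -77 * B\<^sup>2 + 105 * A * D + 60 * A * C = 0)"
  using A_equivalent_cusp45_imp[OF assms(1,3,4)] A_equivalent_cusp45_if[OF assms(1,3,4)]
  unfolding A_def B_def C_def D_def by blast

end
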